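(* Let $d\ge 3$, let $R$ be a positive integer and let $\alpha\in[0,1]$. Let $B\subseteq\mathbb{Z}^d$ be finite with $0\in B$, and let $x_1,\ldots,x_n\in\mathbb{Z}^d$ be such that the sets $x_i+B$, $1\le i\le n$, are (pairwise) disjoint. Then, for any $E\in\mathcal{F}_B$ with $\pi_\alpha(E)>0$, $$\mu_{\alpha,R}\left(\bigcap_{i=1}^n\theta_{x_i}E\right)\le \pi_\alpha(E)^n\cdot\prod_{\substack{u,v\in\bigcup_{i=1}^n(x_i+B)\\ u\prec v}}\left(1+h_R(u,v)\cdot\left(\pi_\alpha(E)^{-2}-1\right)\right).$$
   Context: Let $|\cdot|_1$ be the $\ell^1$-norm on $\mathbb{Z}^d$ and, for a positive integer $R$, let $B_1(R)=\{x\in\mathbb{Z}^d:|x|_1\le R\}$. Voter model and $\mu_{\alpha,R}$. The voter model on $\mathbb{Z}^d$ with range $R$ is the Markov process $(\xi_t)_{t\ge0}$ on $\{0,1\}^{\mathbb{Z}^d}$ with pregenerator, for $f:\{0,1\}^{\mathbb{Z}^d}\to\mathbb{R}$ depending on finitely many coordinates, $$(\mathcal{L}f)(\xi)=\sum_{\substack{x,y\in\mathbb{Z}^d:\\ 0<|x-y|_1\le R}}\frac{f(\xi^{y\to x})-f(\xi)}{|B_1(R)|-1},$$ where $\xi^{y\to x}(z)=\xi(z)$ if $z\ne x$ and $\xi^{y\to x}(x)=\xi(y)$. For $\alpha\in[0,1]$, $\mu_{\alpha,R}$ denotes the distributional limit (known to exist), as $t\to\infty$, of $\xi_t$ when $(\xi_0(x))_{x\in\mathbb{Z}^d}$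 are i.i.d. Bernoulli($\alpha$). Equivalently (a known consequence of duality), $\mu_{\alpha,R}$ is obtained as follows. Start one particle at each site of $\mathbb{Z}^d$; particles perform continuous-time random walks, each jumping at rate $1$ from its location $x$ to a uniformly chosen site $y$ with $0<|x-y|_1\le R$; when a particle jumps onto an occupied site the two particles coalesce into one. Partition $\mathbb{Z}^d$ by declaring $x,y$ to be in the same class if the particles started at $x$ and $y$ eventually coalesce. Given the partition, independently assign to each class (all of its sites) the value $1$ with probability $\alpha$ and $0$ with probability $1-\alpha$. The resulting configuration in $\{0,1\}^{\mathbb{Z}^d}$ has law $\mu_{\alpha,R}$. Product measure. $\pi_\alpha$ is the product over $\mathbb{Z}^d$ of Bernoulli($\alpha$) distributions on $\{0,1\}^{\mathbb{Z}^d}$. Events and translations. For $A\subseteq\mathbb{Z}^d$ finite, $\mathcal{F}_A$ is the collection of sets of the form $\{\xi\in\{0,1\}^{\mathbb{Z}^d}:\xi|_A\in E_0\}$ with $E_0\subseteq\{0,1\}^A$. For $x\in\mathbb{Z}^d$, $(\tau_x\xi)(y)=\xi(y-x)$ for $y\in\mathbb{Z}^d$, and $\theta_xE=\{\tau_x\xi:\xi\in E\}$; thus $\theta_xE\in\mathcal{F}_{A+x}$ if $E\in\mathcal{F}_A$. Meeting probability. For distinct $u,v\in\mathbb{Z}^d$, let $(X^u_t)_{t\ge0}$ and $(X^v_t)_{t\ge0}$ be independent $R$-spread-out random walks started at $u$ and $v$, i.e. continuous-time Markov chains on $\mathbb{Z}^d$ with generator $(Lf)(x)=\sum_{y:\,0<|x-y|_1\le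 R}\frac{f(y)-f(x)}{|B_1(R)|-1}$. Then $h_R(u,v)$ is the probability that there exists $t\ge 0$ with $X^u_t=X^v_t$. Ordering. $\prec$ is a fixed well-ordering of $\mathbb{Z}^d$; the product over $u\prec v$ is thus a product over unordered pairs of distinct vertices, each counted once. *)

theory Defs
  imports "HOL-Probability.Probability"
begin

section \<open>The lattice, configurations and events\<close>

text \<open>The lattice $\mathbb{Z}^d$ is \<open>int ^ 'd\<close> with \<open>d = CARD('d)\<close>. A configuration in
  $\{0,1\}^{\mathbb{Z}^d}$ is a Boolean function, with \<open>True\<close> for 1 and \<open>False\<close> for 0; the type
  carries the product topology of the discrete topology on \<open>bool\<close>.\<close>

type_synonym 'd config = "int ^ 'd \<Rightarrow> bool"

definition l1_norm :: "int ^ 'd::finite \<Rightarrow> int" where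
  "l1_norm x = (\<Sum>i\<in>UNIV. \<bar>x $ i\<bar>)"

definition B1 :: "nat \<Rightarrow> (int ^ 'd::finite) set" where
  "B1 R = {x. l1_norm x \<le> int R}"

definition config_space :: "'d::finite config measure" where
  "config_space = Pi\<^sub>M UNIV (\<lambda>_. count_space UNIV)"

definition bernoulli_product :: "real \<Rightarrow> 'd::finite config measure" where
  "bernoulli_product \<alpha> = Pi\<^sub>M UNIV (\<lambda>_. measure_pmf (bernoulli_pmf \<alpha>))"

definition cylinder_events :: "(int ^ 'd::finite) set \<Rightarrow> 'd config set set" where
  "cylinder_events A = {{\<xi>. restrict \<xi> A \<in> E0} | E0. E0 \<subseteq> (A \<rightarrow>\<^sub>E UNIV)}"

definition shift_config :: "int ^ 'd::finite \<Rightarrow> 'd config \<Rightarrow> 'd config" where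
  "shift_config x \<xi> = (\<lambda>y. \<xi> (y - x))"

definition shift_event :: "int ^ 'd::finite \<Rightarrow> 'd config set \<Rightarrow> 'd config set" where
  "shift_event x E = shift_config x ` E"


section \<open>The voter model\<close>

definition finitely_dependent :: "('d::finite config \<Rightarrow> real) \<Rightarrow> bool" where
  "finitely_dependent f \<longleftrightarrow>
     (\<exists>A. finite A \<and> (\<forall>\<xi> \<eta>. (\<forall>x\<in>A. \<xi> x = \<eta> x) \<longrightarrow> f \<xi> = f \<eta>))"

text \<open>For finitely dependent \<open>f\<close> only finitely many terms of the sum are nonzero.\<close>

definition voter_pregenerator ::
    "nat \<Rightarrow> ('d::finite config \<Rightarrow> real) \<Rightarrow> 'd config \<Rightarrow> real" where
  "voter_pregenerator R f \<xi> =
     (\<Sum>\<^sub>\<infinity>(x, y)\<in>{(x, y). 0 < l1_norm (x - y) \<and> l1_norm (x - y) \<le> int R}.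
        (f (\<xi>(x := \<xi> y)) - f \<xi>) / (real (card (B1 R :: (int ^ 'd) set)) - 1))"

text \<open>\<open>P t \<xi>\<close> is the law at time \<open>t\<close> of the process started from \<open>\<xi>\<close>. The predicate says that
  \<open>P\<close> is the transition function of a Feller process on the compact space of configurations whose
  generator extends the pregenerator. It determines \<open>P\<close> on \<open>t \<ge> 0\<close>, because the closure of the
  pregenerator is a Markov generator (Liggett, Interacting Particle Systems, Chapter I).\<close>

definition voter_transition_function ::
    "nat \<Rightarrow> (real \<Rightarrow> 'd::finite config \<Rightarrow> 'd config measure) \<Rightarrow> bool" where
  "voter_transition_function R P \<longleftrightarrow>
     (\<forall>t\<ge>0. P t \<in> config_space \<rightarrow>\<^sub>M prob_algebra config_space) \<and>
     (\<forall>\<xi>. P 0 \<xi> = return config_space \<xi>) \<and>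
     (\<forall>s\<ge>0. \<forall>t\<ge>0. \<forall>\<xi>. P (s + t) \<xi> = P s \<xi> \<bind> P t) \<and>
     (\<forall>f :: 'd config \<Rightarrow> real. continuous_on UNIV f \<longrightarrow>
        (\<forall>t\<ge>0. continuous_on UNIV (\<lambda>\<xi>. \<integral>\<eta>. f \<eta> \<partial>P t \<xi>)) \<and>
        uniform_limit UNIV (\<lambda>t \<xi>. \<integral>\<eta>. f \<eta> \<partial>P t \<xi>) f (at_right 0)) \<and>
     (\<forall>f. finitely_dependent f \<longrightarrow>
        uniform_limit UNIV (\<lambda>t \<xi>. ((\<integral>\<eta>. f \<eta> \<partial>P t \<xi>) - f \<xi>) / t)
          (voter_pregenerator R f) (at_right 0))"

definition converges_in_distribution ::
    "(real \<Rightarrow> 'd::finite config measure) \<Rightarrow> 'd config measure \<Rightarrow> bool" where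
  "converges_in_distribution \<nu> \<mu> \<longleftrightarrow>
     prob_space \<mu> \<and> sets \<mu> = sets config_space \<and>
     (\<forall>f :: 'd config \<Rightarrow> real. continuous_on UNIV f \<longrightarrow>
        ((\<lambda>t. \<integral>\<xi>. f \<xi> \<partial>\<nu> t) \<longlongrightarrow> (\<integral>\<xi>. f \<xi> \<partial>\<mu>)) at_top)"

text \<open>The law \<open>\<mu>\<^sub>\<alpha>\<^sub>,\<^sub>R\<close>: the distributional limit of the voter model started from the Bernoulli product
  measure. It is known that exactly one such \<open>\<mu>\<close> exists.\<close>

definition voter_limit_law :: "nat \<Rightarrow> real \<Rightarrow> 'd::finite config measure \<Rightarrow> bool" where
  "voter_limit_law R \<alpha> \<mu> \<longleftrightarrow>
     (\<exists>P. voter_transition_function R P \<and>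
          converges_in_distribution (\<lambda>t. bernoulli_product \<alpha> \<bind> P t) \<mu>)"


section \<open>Spread-out random walks and their meeting probability\<close>

text \<open>The generator $(Lf)(x) = \sum_{0<|x-y|_1\le R} (f(y)-f(x))/(|B_1(R)|-1)$ has total jump rate 1
  at every site and uniform jump distribution on $B_1(R)\setminus\{0\}$. The chain is realised in the
  standard way, from i.i.d. pairs of an exponential holding time of rate 1 and an independent
  jump: \<open>\<omega> k\<close> holds the \<open>k\<close>-th holding time and the jump made at its end.\<close>

definition walk_space :: "nat \<Rightarrow> (nat \<Rightarrow> real \<times> (int ^ 'd::finite)) measure" where
  "walk_space R = Pi\<^sub>M UNIV (\<lambda>_. density lborel (exponential_density 1) \<Otimes>\<^sub>M
                                measure_pmf (pmf_of_set (B1 R - {0})))"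

text \<open>Almost surely the partial sums of the holding times increase to infinity, and then this is
  the number of jumps made up to and including time \<open>t\<close>.\<close>

definition jump_count :: "(nat \<Rightarrow> real \<times> 'a) \<Rightarrow> real \<Rightarrow> nat" where
  "jump_count \<omega> t = (LEAST n. t < (\<Sum>k\<le>n. fst (\<omega> k)))"

definition walk :: "int ^ 'd \<Rightarrow> (nat \<Rightarrow> real \<times> (int ^ 'd::finite)) \<Rightarrow> real \<Rightarrow> int ^ 'd" where
  "walk u \<omega> t = u + (\<Sum>k<jump_count \<omega> t. snd (\<omega> k))"

definition meeting_prob :: "nat \<Rightarrow> int ^ 'd::finite \<Rightarrow> int ^ 'd \<Rightarrow> real" where
  "meeting_prob R u v =
     measure (walk_space R \<Otimes>\<^sub>M walk_space R)
       {(\<omega>, \<omega>'). \<exists>t\<ge>0. walk u \<omega> t = walk v \<omega>' t}"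

end

theory Submission
  imports Defs
begin

text \<open>By duality, the probability of the event under the law at time \<open>t\<close> is an expectation over
  coalescing random walks started from the labels \<open>A = \<Union>i. x i + B\<close>. If walks from several labels
  coalesce, one can discard all but one of the blocks involved, which costs a factor
  \<open>\<pi>(E)\<^sup>-\<^sup>1\<close> for each discarded block; a cluster of \<open>m\<close> labels costs at most
  \<open>m - 1 \<le> 2 * (m div 2)\<close> factors. The sum of \<open>m div 2\<close> over the clusters is the number of
  collisions of the corresponding annihilating walks. Annihilating pairs are disjoint, so the
  expectation of \<open>\<pi>(E)\<^sup>-\<^sup>2\<close> to this number is at most the sum, over all matchings of \<open>A\<close>, of the
  products of \<open>h\<^sub>R(u,v) (\<pi>(E)\<^sup>-\<^sup>2 - 1)\<close> over the matched pairs. Enlarging matchings to arbitrary sets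
  of pairs gives the product.

  The dual process is never constructed: the matching sum, evaluated at the positions occupied by an
  odd number of labels, is a superharmonic function for the coalescing dynamics of labels, and a
  maximum principle compares it with the solution of the evolution equation of the voter model.\<close>

section \<open>Matching sums\<close>

text \<open>The event is arbitrary, in particular not monotone, so no correlation inequality is at
  hand: the only operation on it is to drop blocks. The product over all pairs is not itself a
  candidate for the comparison function: expanded, it contains terms \<open>k x v * k x v'\<close>,
  and a product of two superharmonic functions of \<open>x\<close> need not be superharmonic. A
  matching uses every vertex at most once, so the matching sum is affine in the weights at each
  vertex and inherits superharmonicity from them. The product bound comes in only at the end. Of the
  meeting weight, the argument uses symmetry, nonnegativity, the value 1 on the diagonal and
  superharmonicity in one argument. Any function with these properties that lies below the meeting
  probability will do, which leaves room to choose a more convenient meeting event. The transition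
  function is given through difference quotients at time 0, so the evolution equation appears as a
  one-sided estimate of increments, and the comparison is built for that form.\<close>

definition matchings :: "'a set \<Rightarrow> 'a set set set" where
  "matchings S = {F. F \<subseteq> {e. e \<subseteq> S \<and> card e = 2} \<and> disjoint F}"

text \<open>Edges are unordered while \<open>k\<close> takes ordered arguments; the description is
  well defined once \<open>k\<close> is symmetric.\<close>

definition edge_weight :: "('a \<Rightarrow> 'a \<Rightarrow> real) \<Rightarrow> 'a set \<Rightarrow> real" where
  "edge_weight k e = (THE r. \<exists>u v. e = {u, v} \<and> r = k u v)"

definition matching_sum :: "('a \<Rightarrow> 'a \<Rightarrow> real) \<Rightarrow> 'a set \<Rightarrow> real" where
  "matching_sum k S = (\<Sum>F\<in>matchings S. \<Prod>e\<in>F. edge_weight k e)"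

lemma edge_weight_doubleton:
  assumes "\<And>u v. k u v = k v u"
  shows "edge_weight k {u, v} = k u v"
  unfolding edge_weight_def
  by (rule the_equality) (use assms in \<open>auto simp: doubleton_eq_iff\<close>)

lemma matchings_empty: "matchings {} = {{}}"
  by (auto simp: matchings_def)

lemma finite_matchings: "finite S \<Longrightarrow> finite (matchings S)"
  by (rule finite_subset[of _ "Pow (Pow S)"]) (auto simp: matchings_def)

lemma finite_matching: "finite S \<Longrightarrow> F \<in> matchings S \<Longrightarrow> finite F"
  by (rule finite_subset[of _ "Pow S"]) (auto simp: matchings_def)

lemma matching_weight_nonneg:
  assumes sym: "\<And>u v. k u v = k v u" and nonneg: "\<And>u v. 0 \<le> k u v"
    and "F \<in> matchings S"
  shows "0 \<le> (\<Prod>e\<in>F. edge_weight k e)"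
proof (rule prod_nonneg)
  fix e assume "e \<in> F"
  then have "card e = 2" using assms by (auto simp: matchings_def)
  then obtain u v where "e = {u, v}" by (auto simp: card_2_iff)
  then show "0 \<le> edge_weight k e" using edge_weight_doubleton[of k, OF sym] nonneg by simp
qed

lemma matching_sum_mono:
  assumes "\<And>u v. k u v = k v u" "\<And>u v. 0 \<le> k u v" "finite S" "T \<subseteq> S"
  shows "matching_sum k T \<le> matching_sum k S"
  unfolding matching_sum_def
proof (rule sum_mono2[OF finite_matchings[OF assms(3)]])
  show "matchings T \<subseteq> matchings S" using assms(4) unfolding matchings_def by fast
qed (use assms(1,2) matching_weight_nonneg[of k] in blast)

lemma matching_sum_empty: "matching_sum k {} = 1"
  by (simp add: matching_sum_def matchings_empty)

lemma matching_sum_ge_1: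
  assumes "\<And>u v. k u v = k v u" "\<And>u v. 0 \<le> k u v" "finite S"
  shows "1 \<le> matching_sum k S"
  using matching_sum_mono[of k S "{}"] assms by (simp add: matching_sum_empty)

text \<open>Either \<open>x\<close> is unmatched, or it has a unique partner \<open>v\<close>, and
  removing that edge leaves a matching that avoids both ends.\<close>

lemma matchings_insert:
  assumes "x \<notin> S"
  shows "matchings (insert x S) =
    matchings S \<union> (\<Union>v\<in>S. insert {x, v} ` matchings (S - {v}))"
proof (intro equalityI subsetI)
  fix F assume F: "F \<in> matchings (insert x S)"
  show "F \<in> matchings S \<union> (\<Union>v\<in>S. insert {x, v} ` matchings (S - {v}))"
  proof (cases "x \<in> \<Union>F")
    case False
    then have "F \<in> matchings S" using F by (auto simp: matchings_def)
    then show ?thesis ..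
  next
    case True
    then obtain e where e: "e \<in> F" "x \<in> e" by auto
    have disj: "disjoint F" using F by (simp add: matchings_def)
    have "card e = 2" "e \<subseteq> insert x S" using F e by (auto simp: matchings_def)
    then obtain v where v: "e = {x, v}" "v \<noteq> x" using e
      by (auto simp: card_2_iff)
    with \<open>e \<subseteq> insert x S\<close> have "v \<in> S" by auto
    have "e' \<inter> e = {}" if "e' \<in> F - {e}" for e'
      using disj that e unfolding disjoint_def by blast
    then have "e' \<subseteq> S - {v} \<and> card e' = 2" if "e' \<in> F - {e}" for e'
      using F v that unfolding matchings_def by fast
    then have "F - {e} \<in> matchings (S - {v})"
      using pairwise_subset[OF disj, of "F - {e}"] unfolding matchings_def by blast
    moreover have "F = insert {x, v} (F - {e})" using e v by auto
    ultimately show ?thesis using \<open>v \<in> S\<close> by blast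
  qed
next
  fix F assume F: "F \<in> matchings S \<union> (\<Union>v\<in>S. insert {x, v} ` matchings (S - {v}))"
  show "F \<in> matchings (insert x S)"
  proof (cases "F \<in> matchings S")
    case True
    then show ?thesis by (auto simp: matchings_def)
  next
    case False
    then obtain v F' where v: "v \<in> S" "F = insert {x, v} F'" "F' \<in> matchings (S - {v})"
      using F by auto
    then have "{x, v} \<inter> e = {}" if "e \<in> F'" for e
      using assms that by (auto simp: matchings_def)
    moreover have "x \<noteq> v" using assms v by auto
    ultimately have "disjoint F"
      using v unfolding matchings_def by (simp add: disjoint_def)
    moreover have "e \<subseteq> insert x S \<and> card e = 2" if "e \<in> F" for e
      using that v \<open>x \<noteq> v\<close> unfolding matchings_def by auto
    ultimately show ?thesis unfolding matchings_def by blast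
  qed
qed

text \<open>The recursion exhibits the sum as an affine function of the weights \<open>k x v\<close>
  at the new vertex. This is the form in which averages over a jump of \<open>x\<close> can be
  taken.\<close>

lemma matching_sum_insert:
  assumes sym: "\<And>u v. k u v = k v u" and S: "finite S" "x \<notin> S"
  shows "matching_sum k (insert x S) =
    matching_sum k S + (\<Sum>v\<in>S. k x v * matching_sum k (S - {v}))"
proof -
  define w where "w F = (\<Prod>e\<in>F. edge_weight k e)" for F
  have new: "{x, v} \<notin> F" if "F \<in> matchings (S - {v'})" for v v' F
    using that S by (auto simp: matchings_def)
  have inj: "inj_on (insert {x, v}) (matchings (S - {v'}))" for v v'
    using new by (intro inj_onI) (metis insert_ident)
  have "sum w (matchings (insert x S)) =
      sum w (matchings S) + sum w (\<Union>v\<in>S. insert {x, v} ` matchings (S - {v}))"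
    unfolding matchings_insert[OF S(2)]
  proof (rule sum.union_disjoint)
    show "matchings S \<inter> (\<Union>v\<in>S. insert {x, v} ` matchings (S - {v})) = {}"
      using S(2) by (auto simp: matchings_def)
  qed (use S in \<open>auto intro!: finite_matchings\<close>)
  also have "sum w (\<Union>v\<in>S. insert {x, v} ` matchings (S - {v})) =
      (\<Sum>v\<in>S. sum w (insert {x, v} ` matchings (S - {v})))"
  proof (rule sum.UNION_disjoint)
    show "\<forall>v\<in>S. \<forall>v'\<in>S. v \<noteq> v' \<longrightarrow>
      insert {x, v} ` matchings (S - {v}) \<inter> insert {x, v'} ` matchings (S - {v'}) = {}"
    proof (intro ballI impI equals0I)
      fix v v' F assume v: "v \<in> S" "v' \<in> S" "v \<noteq> v'"
        and F: "F \<in> insert {x, v} ` matchings (S - {v}) \<inter> insert {x, v'} ` matchings (S - {v'})"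
      from F obtain F' F'' where F': "F = insert {x, v} F'" "F' \<in> matchings (S - {v})"
        and "F = insert {x, v'} F''" by (elim IntE imageE)
      then have "{x, v'} \<in> F" by (metis insertI1)
      moreover have "{x, v'} \<notin> F'" using new[OF F'(2)] .
      ultimately show False using F'(1) v(3) by (simp add: doubleton_eq_iff)
    qed
  qed (use S in \<open>auto intro!: finite_matchings\<close>)
  also have "\<dots> = (\<Sum>v\<in>S. k x v * sum w (matchings (S - {v})))"
  proof (rule sum.cong)
    fix v assume "v \<in> S"
    have "sum w (insert {x, v} ` matchings (S - {v})) =
        (\<Sum>F\<in>matchings (S - {v}). w (insert {x, v} F))"
      using sum.reindex[OF inj] by simp
    also have "\<dots> = (\<Sum>F\<in>matchings (S - {v}). k x v * w F)"
    proof (rule sum.cong)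
      fix F assume F: "F \<in> matchings (S - {v})"
      then have "finite F" using S finite_matching by blast
      then show "w (insert {x, v} F) = k x v * w F"
        using new[OF F, of v] edge_weight_doubleton[of k, OF sym, of x v] by (simp add: w_def)
    qed simp
    finally show "sum w (insert {x, v} ` matchings (S - {v})) = k x v * sum w (matchings (S - {v}))"
      by (simp add: sum_distrib_left)
  qed simp
  finally show ?thesis by (simp add: matching_sum_def w_def)
qed

lemma one_plus_sum_le_prod:
  fixes f :: "'a \<Rightarrow> real"
  assumes "\<And>x. x \<in> S \<Longrightarrow> 0 \<le> f x"
  shows "1 + sum f S \<le> (\<Prod>x\<in>S. 1 + f x)"
  using assms
proof (induction S rule: infinite_finite_induct)
  case (insert x S)
  have "1 \<le> (\<Prod>x\<in>S. 1 + f x)" by (rule prod_ge_1) (use insert.prems in auto)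
  then have "f x * 1 \<le> f x * (\<Prod>x\<in>S. 1 + f x)"
    by (rule mult_left_mono) (use insert.prems in auto)
  with insert show ?case by (simp add: algebra_simps)
qed simp_all

text \<open>Vertices are added one at a time. Replacing \<open>S - {v}\<close> by \<open>S\<close>
  in the recursion gives up disjointness of the edges, and \<open>1 + (\<Sum>v\<in>S. k x v)\<close>
  is then at most the product of the new factors.\<close>

lemma matching_sum_le_prod:
  assumes sym: "\<And>u v. k u v = k v u" and nonneg: "\<And>u v. 0 \<le> k u v"
    and "finite S" and r: "total_on S r" "antisym r"
  shows "matching_sum k S \<le> (\<Prod>(u, v)\<in>{(u, v). u \<in> S \<and> v \<in> S \<and> u \<noteq> v \<and> (u, v) \<in> r}. 1 + k u v)"
  using \<open>finite S\<close> r(1)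
proof (induction S)
  case empty
  then show ?case by (simp add: matching_sum_empty)
next
  case (insert x S)
  define Q where "Q T = {(u, v). u \<in> T \<and> v \<in> T \<and> u \<noteq> v \<and> (u, v) \<in> r}" for T
  \<comment> \<open>The orientation of the pair of \<open>x\<close> and \<open>v\<close> that lies
    in \<open>r\<close>: totality provides one, and antisymmetry makes it the only one.\<close>
  define f where "f v = (if (x, v) \<in> r then (x, v) else (v, x))" for v
  have finQ: "finite (Q T)" if "finite T" for T
    by (rule finite_subset[of _ "T \<times> T"]) (use that in \<open>auto simp: Q_def\<close>)
  have Q: "Q (insert x S) = Q S \<union> f ` S"
  proof (intro equalityI subsetI)
    fix e assume "e \<in> Q (insert x S)"
    then obtain u v where e: "e = (u, v)" "u \<in> insert x S" "v \<in> insert x S" "u \<noteq> v" "(u, v) \<in> r"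
      by (auto simp: Q_def)
    show "e \<in> Q S \<union> f ` S"
    proof (cases "u = x \<or> v = x")
      case True
      then have "(e = f v \<and> v \<in> S) \<or> (e = f u \<and> u \<in> S)"
        using e r(2) by (auto simp: f_def antisym_def)
      then show ?thesis by auto
    qed (use e in \<open>auto simp: Q_def\<close>)
  next
    fix e assume "e \<in> Q S \<union> f ` S"
    then show "e \<in> Q (insert x S)"
      using insert.prems insert.hyps by (auto simp: Q_def f_def total_on_def split: if_splits)
  qed
  have inj: "inj_on f S"
    using insert.hyps by (auto simp: inj_on_def f_def split: if_splits)
  have disj: "Q S \<inter> f ` S = {}"
    using insert.hyps by (auto simp: Q_def f_def split: if_splits)
  have "matching_sum k (insert x S) \<le> matching_sum k S + (\<Sum>v\<in>S. k x v * matching_sum k S)"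
    unfolding matching_sum_insert[of k, OF sym insert.hyps]
    by (intro add_mono sum_mono mult_left_mono matching_sum_mono) (use insert.hyps nonneg sym in auto)
  also have "\<dots> = matching_sum k S * (1 + (\<Sum>v\<in>S. k x v))"
    by (simp add: algebra_simps sum_distrib_left)
  also have "\<dots> \<le> (\<Prod>(u, v)\<in>Q S. 1 + k u v) * (\<Prod>v\<in>S. 1 + k x v)"
  proof (rule mult_mono)
    show "matching_sum k S \<le> (\<Prod>(u, v)\<in>Q S. 1 + k u v)"
      using insert.IH insert.prems by (simp add: Q_def total_on_def)
    show "1 + (\<Sum>v\<in>S. k x v) \<le> (\<Prod>v\<in>S. 1 + k x v)"
      by (rule one_plus_sum_le_prod) (use nonneg in auto)
  qed (use nonneg in \<open>auto intro!: prod_nonneg add_nonneg_nonneg sum_nonneg\<close>)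
  also have "(\<Prod>v\<in>S. 1 + k x v) = (\<Prod>(u, v)\<in>f ` S. 1 + k u v)"
    unfolding prod.reindex[OF inj] using sym by (intro prod.cong) (auto simp: f_def)
  also have "(\<Prod>(u, v)\<in>Q S. 1 + k u v) * \<dots> = (\<Prod>(u, v)\<in>Q (insert x S). 1 + k u v)"
    unfolding Q by (rule prod.union_disjoint[symmetric]) (use insert.hyps disj finQ in auto)
  finally show ?case by (simp add: Q_def)
qed

section \<open>Meetings of two random walks\<close>

lemma measurable_add_count_space:
  fixes f g :: "'a \<Rightarrow> 'b::{countable, plus}"
  assumes "f \<in> M \<rightarrow>\<^sub>M count_space UNIV" "g \<in> M \<rightarrow>\<^sub>M count_space UNIV"
  shows "(\<lambda>x. f x + g x) \<in> M \<rightarrow>\<^sub>M count_space UNIV"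
  by (rule measurable_compose_countable[OF _ assms(1)], rule measurable_compose[OF assms(2)]) simp

lemma measurable_sum_count_space:
  fixes f :: "nat \<Rightarrow> 'a \<Rightarrow> 'b::{countable, comm_monoid_add}"
  assumes "\<And>k. f k \<in> M \<rightarrow>\<^sub>M count_space UNIV"
  shows "(\<lambda>x. \<Sum>k<n. f k x) \<in> M \<rightarrow>\<^sub>M count_space UNIV"
  by (induction n) (simp_all add: assms measurable_add_count_space)

definition step_measure :: "nat \<Rightarrow> (real \<times> (int ^ 'd::finite)) measure" where
  "step_measure R = density lborel (exponential_density 1) \<Otimes>\<^sub>M
     measure_pmf (pmf_of_set (B1 R - {0}))"

lemma walk_space_eq: "walk_space R = Pi\<^sub>M UNIV (\<lambda>_. step_measure R)"
  by (simp add: walk_space_def step_measure_def)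

lemma prob_space_step_measure: "prob_space (step_measure R)"
proof -
  interpret A: prob_space "density lborel (exponential_density 1)"
    by (rule prob_space_exponential_density) simp
  interpret P: pair_prob_space "density lborel (exponential_density 1)"
      "measure_pmf (pmf_of_set (B1 R - {0 :: int ^ 'd}))" ..
  show ?thesis unfolding step_measure_def by unfold_locales
qed

lemma sets_step_measure [measurable_cong]:
  "sets (step_measure R) = sets (borel \<Otimes>\<^sub>M count_space UNIV)"
  unfolding step_measure_def by (rule sets_pair_measure_cong) auto

lemma space_step_measure [simp]: "space (step_measure R) = UNIV"
  by (simp add: step_measure_def space_pair_measure)

lemma sets_walk_space [measurable_cong]:
  "sets (walk_space R) = sets (Pi\<^sub>M UNIV (\<lambda>_. borel \<Otimes>\<^sub>M count_space UNIV))"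
  unfolding walk_space_eq by (rule sets_PiM_cong) (auto simp: sets_step_measure)

lemma space_walk_space [simp]: "space (walk_space R) = UNIV"
  by (simp add: walk_space_eq space_PiM)

lemma prob_space_walk_space: "prob_space (walk_space R)"
  unfolding walk_space_eq by (intro prob_space_PiM prob_space_step_measure)

definition elapsed :: "(nat \<Rightarrow> real \<times> 'a) \<Rightarrow> nat \<Rightarrow> real" where
  "elapsed \<omega> n = (\<Sum>k<n. fst (\<omega> k))"

definition displacement :: "(nat \<Rightarrow> real \<times> 'a::comm_monoid_add) \<Rightarrow> nat \<Rightarrow> 'a" where
  "displacement \<omega> n = (\<Sum>k<n. snd (\<omega> k))"

lemma measurable_elapsed [measurable]: "(\<lambda>\<omega>. elapsed \<omega> n) \<in> borel_measurable (walk_space R)"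
  unfolding elapsed_def by measurable

lemma measurable_displacement [measurable]:
  "(\<lambda>\<omega> :: nat \<Rightarrow> real \<times> (int ^ 'd::finite). displacement \<omega> n) \<in> walk_space R \<rightarrow>\<^sub>M count_space UNIV"
  unfolding displacement_def by (rule measurable_sum_count_space) measurable

lemma measurable_walk [measurable]:
  "(\<lambda>\<omega>. walk u \<omega> t) \<in> walk_space R \<rightarrow>\<^sub>M count_space UNIV"
proof -
  have [measurable]: "(\<lambda>\<omega>. jump_count \<omega> t) \<in> walk_space R \<rightarrow>\<^sub>M count_space UNIV"
    unfolding jump_count_def by measurable
  have "(\<lambda>\<omega>. u + displacement \<omega> (jump_count \<omega> t)) \<in> walk_space R \<rightarrow>\<^sub>M count_space UNIV"
    by (rule measurable_add_count_space) measurable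
  then show ?thesis by (simp add: walk_def displacement_def)
qed

text \<open>The least index whose partial sum exceeds \<open>t\<close> stays the least one until
  time reaches that partial sum. Monotonicity of the partial sums plays no part, so the statement
  holds for every \<omega>.\<close>

lemma jump_count_right_constant:
  "\<exists>e>0. \<forall>s. t \<le> s \<and> s < t + e \<longrightarrow> jump_count \<omega> s = jump_count \<omega> t"
proof (cases "\<exists>n. t < (\<Sum>k\<le>n. fst (\<omega> k))")
  case True
  define n where "n = jump_count \<omega> t"
  have n: "t < (\<Sum>k\<le>n. fst (\<omega> k))" using LeastI_ex[OF True] by (simp add: n_def jump_count_def)
  have "jump_count \<omega> s = n" if "t \<le> s" "s < (\<Sum>k\<le>n. fst (\<omega> k))" for s
    unfolding jump_count_def
  proof (rule Least_equality)
    fix m assume "s < (\<Sum>k\<le>m. fst (\<omega> k))"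
    then show "n \<le> m" using that unfolding n_def jump_count_def by (intro Least_le) simp
  qed (use that in simp)
  then have "\<forall>s. t \<le> s \<and> s < t + ((\<Sum>k\<le>n. fst (\<omega> k)) - t) \<longrightarrow> jump_count \<omega> s = jump_count \<omega> t"
    unfolding add.commute[of t] diff_add_cancel n_def by blast
  moreover have "0 < (\<Sum>k\<le>n. fst (\<omega> k)) - t" using n by simp
  ultimately show ?thesis by blast
next
  case False
  then have "\<not> s < (\<Sum>k\<le>n. fst (\<omega> k))" if "t \<le> s" for s n
    using that by (meson le_less_trans)
  \<comment> \<open>After an explosion the predicate under \<open>LEAST\<close> is false for every
    index at both times, so both counts are the same default value.\<close>
  then have "jump_count \<omega> s = jump_count \<omega> t" if "t \<le> s" for s
    using that by (simp add: jump_count_def)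
  then show ?thesis using zero_less_one by blast
qed

text \<open>Right-continuity holds even on the null set where the walk explodes, hence rational times
  detect every meeting.\<close>

lemma meeting_rational:
  "(\<exists>t\<ge>0. walk u \<omega> t = walk v \<omega>' t) \<longleftrightarrow> (\<exists>q::rat. 0 \<le> q \<and> walk u \<omega> (of_rat q) = walk v \<omega>' (of_rat q))"
proof
  assume "\<exists>t\<ge>0. walk u \<omega> t = walk v \<omega>' t"
  then obtain t where t: "t \<ge> 0" "walk u \<omega> t = walk v \<omega>' t" by auto
  obtain e e' where e: "e > 0" "\<And>s. t \<le> s \<Longrightarrow> s < t + e \<Longrightarrow> jump_count \<omega> s = jump_count \<omega> t"
    and e': "e' > 0" "\<And>s. t \<le> s \<Longrightarrow> s < t + e' \<Longrightarrow> jump_count \<omega>' s = jump_count \<omega>' t"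
    using jump_count_right_constant[of t \<omega>] jump_count_right_constant[of t \<omega>'] by metis
  have "t < t + min e e'" using e e' by simp
  then obtain q where q: "t < of_rat q" "of_rat q < t + min e e'" using of_rat_dense by blast
  then have "walk u \<omega> (of_rat q) = walk v \<omega>' (of_rat q)"
    using e(2)[of "of_rat q"] e'(2)[of "of_rat q"] t by (simp add: walk_def)
  moreover have "0 \<le> q" using q t by (metis less_eq_real_def order.trans zero_le_of_rat_iff)
  ultimately show "\<exists>q::rat. 0 \<le> q \<and> walk u \<omega> (of_rat q) = walk v \<omega>' (of_rat q)" by blast
next
  assume "\<exists>q::rat. 0 \<le> q \<and> walk u \<omega> (of_rat q) = walk v \<omega>' (of_rat q)"
  then obtain q :: rat where "0 \<le> q" "walk u \<omega> (of_rat q) = walk v \<omega>' (of_rat q)" by blast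
  then show "\<exists>t\<ge>0. walk u \<omega> t = walk v \<omega>' t" by (intro exI[of _ "of_rat q"]) simp
qed

text \<open>Comparing the measure of a smaller event with that of the meeting event requires the
  latter to be measurable; countably many rational times make it so.\<close>

lemma meeting_event_measurable:
  "{(\<omega>, \<omega>'). \<exists>t\<ge>0. walk u \<omega> t = walk v \<omega>' t} \<in> sets (walk_space R \<Otimes>\<^sub>M walk_space R)"
proof -
  have "{x \<in> space (walk_space R \<Otimes>\<^sub>M walk_space R). \<exists>q::rat. 0 \<le> q \<and>
      walk u (fst x) (of_rat q) = walk v (snd x) (of_rat q)} \<in> sets (walk_space R \<Otimes>\<^sub>M walk_space R)"
    by measurable
  also have "{x \<in> space (walk_space R \<Otimes>\<^sub>M walk_space R). \<exists>q::rat. 0 \<le> q \<and>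
      walk u (fst x) (of_rat q) = walk v (snd x) (of_rat q)} =
      {(\<omega>, \<omega>'). \<exists>t\<ge>0. walk u \<omega> t = walk v \<omega>' t}"
    unfolding meeting_rational by (auto simp: space_pair_measure)
  finally show ?thesis .
qed

text \<open>Meetings seen from the jump chains, with nonnegative holding times. This event is contained in
  the meeting event and obeys the first-step inequality pointwise, so non-explosion of the walks is
  not needed.\<close>

definition regular_meeting ::
    "int ^ 'd \<Rightarrow> int ^ 'd \<Rightarrow> (nat \<Rightarrow> real \<times> (int ^ 'd::finite)) \<Rightarrow> (nat \<Rightarrow> real \<times> (int ^ 'd)) \<Rightarrow> bool" where
  "regular_meeting u v \<omega> \<omega>' \<longleftrightarrow>
     (\<forall>k. 0 \<le> fst (\<omega> k)) \<and> (\<forall>k. 0 \<le> fst (\<omega>' k)) \<and>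
     (\<exists>n k. max (elapsed \<omega> n) (elapsed \<omega>' k) < min (elapsed \<omega> (Suc n)) (elapsed \<omega>' (Suc k)) \<and>
            u + displacement \<omega> n = v + displacement \<omega>' k)"

lemma regular_meeting_commute: "regular_meeting u v \<omega> \<omega>' \<longleftrightarrow> regular_meeting v u \<omega>' \<omega>"
  unfolding regular_meeting_def by (metis (no_types, opaque_lifting) max.commute min.commute)

lemma measurable_regular_meeting [measurable]:
  "Measurable.pred (walk_space R \<Otimes>\<^sub>M walk_space R) (\<lambda>x. regular_meeting u v (fst x) (snd x))"
proof -
  have [measurable]: "Measurable.pred (walk_space R \<Otimes>\<^sub>M walk_space R)
      (\<lambda>x. u + displacement (fst x) n = v + displacement (snd x) k)" for n k
  proof -
    have "(\<lambda>x. u + displacement (fst x) n) \<in> walk_space R \<Otimes>\<^sub>M walk_space R \<rightarrow>\<^sub>M count_space UNIV"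
      "(\<lambda>x. v + displacement (snd x) k) \<in> walk_space R \<Otimes>\<^sub>M walk_space R \<rightarrow>\<^sub>M count_space UNIV"
      by (rule measurable_add_count_space; measurable)+
    then show ?thesis by measurable
  qed
  show ?thesis unfolding regular_meeting_def by measurable
qed

lemma elapsed_mono:
  assumes "\<And>k. 0 \<le> fst (\<omega> k)" "m \<le> n"
  shows "elapsed \<omega> m \<le> elapsed \<omega> n"
  unfolding elapsed_def by (rule sum_mono2) (use assms in auto)

lemma jump_count_eqI:
  assumes "\<And>k. 0 \<le> fst (\<omega> k)" "elapsed \<omega> n \<le> t" "t < elapsed \<omega> (Suc n)"
  shows "jump_count \<omega> t = n"
  unfolding jump_count_def
proof (rule Least_equality)
  show "t < (\<Sum>k\<le>n. fst (\<omega> k))" using assms(3) by (simp add: elapsed_def lessThan_Suc_atMost)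
next
  fix m assume "t < (\<Sum>k\<le>m. fst (\<omega> k))"
  then have "t < elapsed \<omega> (Suc m)" by (simp add: elapsed_def lessThan_Suc_atMost)
  then show "n \<le> m" using elapsed_mono[of \<omega> "Suc m" n] assms(1,2) by (meson leD not_less_eq_eq order.trans)
qed

lemma regular_meeting_imp_meeting:
  assumes "regular_meeting u v \<omega> \<omega>'"
  shows "\<exists>t\<ge>0. walk u \<omega> t = walk v \<omega>' t"
proof -
  from assms obtain n k where nonneg: "\<And>k. 0 \<le> fst (\<omega> k)" "\<And>k. 0 \<le> fst (\<omega>' k)"
    and nk: "max (elapsed \<omega> n) (elapsed \<omega>' k) < min (elapsed \<omega> (Suc n)) (elapsed \<omega>' (Suc k))"
      "u + displacement \<omega> n = v + displacement \<omega>' k"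
    unfolding regular_meeting_def by blast
  \<comment> \<open>The later of the two arrival times lies in both holding intervals.\<close>
  define t where "t = max (elapsed \<omega> n) (elapsed \<omega>' k)"
  have "jump_count \<omega> t = n" "jump_count \<omega>' t = k"
    using nk(1) nonneg by (auto intro!: jump_count_eqI simp: t_def)
  moreover have "0 \<le> t" using elapsed_mono[of \<omega> 0 n] nonneg(1) by (simp add: t_def elapsed_def le_max_iff_disj)
  ultimately show ?thesis using nk(2) by (auto simp: walk_def displacement_def)
qed

definition regular_meeting_prob :: "nat \<Rightarrow> int ^ 'd::finite \<Rightarrow> int ^ 'd \<Rightarrow> real" where
  "regular_meeting_prob R u v =
     measure (walk_space R \<Otimes>\<^sub>M walk_space R) {(\<omega>, \<omega>'). regular_meeting u v \<omega> \<omega>'}"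

text \<open>The final bound increases with the meeting weights, so a lower estimate of the meeting
  probability is the direction required.\<close>

lemma regular_meeting_prob_le:
  fixes u v :: "int ^ 'd::finite"
  shows "regular_meeting_prob R u v \<le> meeting_prob R u v"
proof -
  interpret W: prob_space "walk_space R :: (nat \<Rightarrow> real \<times> (int ^ 'd)) measure"
    by (rule prob_space_walk_space)
  interpret P: pair_prob_space "walk_space R :: (nat \<Rightarrow> real \<times> (int ^ 'd)) measure"
      "walk_space R :: (nat \<Rightarrow> real \<times> (int ^ 'd)) measure" ..
  show ?thesis unfolding regular_meeting_prob_def meeting_prob_def
    using regular_meeting_imp_meeting
    by (intro P.P.finite_measure_mono meeting_event_measurable) auto
qed

lemma measurable_regular_meeting' [measurable (raw)]:
  assumes "f \<in> N \<rightarrow>\<^sub>M walk_space R" "g \<in> N \<rightarrow>\<^sub>M walk_space R"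
  shows "Measurable.pred N (\<lambda>x. regular_meeting u v (f x) (g x))"
  using measurable_compose[OF measurable_Pair[OF assms] measurable_regular_meeting[where u = u and v = v]]
  by simp

lemma measurable_case_nat_walk_space [measurable (raw)]:
  assumes "f \<in> N \<rightarrow>\<^sub>M step_measure R" "g \<in> N \<rightarrow>\<^sub>M walk_space R"
  shows "(\<lambda>x. case_nat (f x) (g x)) \<in> N \<rightarrow>\<^sub>M walk_space R"
  using assms unfolding walk_space_eq by measurable

lemma measurable_Pair_step_measure [measurable (raw)]:
  assumes "f \<in> borel_measurable N" "g \<in> N \<rightarrow>\<^sub>M count_space UNIV"
  shows "(\<lambda>x. (f x, g x)) \<in> N \<rightarrow>\<^sub>M step_measure R"
  unfolding measurable_cong_sets[OF refl sets_step_measure] using assms by measurable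

section \<open>First-step analysis of regular meetings\<close>

lemma elapsed_case_nat_Suc: "elapsed (case_nat (t, j) \<omega>) (Suc n) = t + elapsed \<omega> n"
  by (simp add: elapsed_def sum.lessThan_Suc_shift del: sum.lessThan_Suc)

lemma displacement_case_nat_Suc: "displacement (case_nat (t, j) \<omega>) (Suc n) = j + displacement \<omega> n"
  by (simp add: displacement_def sum.lessThan_Suc_shift del: sum.lessThan_Suc)

lemma elapsed_0: "elapsed \<omega> 0 = 0" and displacement_0: "displacement \<omega> 0 = 0"
  by (simp_all add: elapsed_def displacement_def)

text \<open>If the walk from \<open>u\<close> jumps first, at time \<open>t\<close>, while the other
  clock still has \<open>r\<close> to run, then restarting at time \<open>t\<close> shifts every
  later clock reading by \<open>t\<close> and leaves overlaps of holding intervals intact.\<close>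

lemma regular_meeting_step:
  assumes "0 \<le> t" "0 \<le> r" and meet: "regular_meeting (u + j) v \<omega> (case_nat (r, j') \<omega>')"
  shows "regular_meeting u v (case_nat (t, j) \<omega>) (case_nat (t + r, j') \<omega>')"
proof -
  let ?\<eta> = "case_nat (t, j) \<omega>" and ?\<eta>' = "case_nat (t + r, j') \<omega>'"
    and ?\<zeta> = "case_nat (r, j') \<omega>'"
  from meet obtain n k where nonneg: "\<And>k. 0 \<le> fst (\<omega> k)" "\<And>k. 0 \<le> fst (?\<zeta> k)"
    and nk: "max (elapsed \<omega> n) (elapsed ?\<zeta> k) < min (elapsed \<omega> (Suc n)) (elapsed ?\<zeta> (Suc k))"
      "u + j + displacement \<omega> n = v + displacement ?\<zeta> k"
    unfolding regular_meeting_def by blast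
  have "0 \<le> fst (\<omega>' k)" for k using nonneg(2)[of "Suc k"] by simp
  with assms(1,2) nonneg(1) have "0 \<le> fst (?\<eta> k)" "0 \<le> fst (?\<eta>' k)" for k
    by (simp_all split: nat.split)
  moreover have "max (elapsed ?\<eta> (Suc n)) (elapsed ?\<eta>' k) < min (elapsed ?\<eta> (Suc (Suc n))) (elapsed ?\<eta>' (Suc k))"
  proof (cases k)
    \<comment> \<open>The second walk has not jumped, so its arrival time is 0 in both pictures and
      is not shifted by \<open>t\<close>. The maximum is attained by the first walk, whose arrival
      time is nonnegative.\<close>
    case 0
    have "0 \<le> elapsed \<omega> n" using elapsed_mono[of \<omega> 0 n] nonneg(1) by (simp add: elapsed_0)
    with 0 nk(1) assms(1) show ?thesis
      by (simp add: elapsed_case_nat_Suc elapsed_0)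
  next
    case (Suc k')
    with nk(1) show ?thesis by (simp add: elapsed_case_nat_Suc)
  qed
  moreover have "u + displacement ?\<eta> (Suc n) = v + displacement ?\<eta>' k"
    using nk(2) by (cases k) (simp_all add: displacement_case_nat_Suc displacement_0 add.assoc)
  ultimately show ?thesis unfolding regular_meeting_def by blast
qed

abbreviation jump_pmf :: "nat \<Rightarrow> (int ^ 'd::finite) pmf" where
  "jump_pmf R \<equiv> pmf_of_set (B1 R - {0})"

lemma nn_integral_step_measure:
  assumes [measurable]: "f \<in> borel_measurable (step_measure R)"
  shows "(\<integral>\<^sup>+s. f s \<partial>step_measure R) =
    (\<integral>\<^sup>+t. ennreal (exponential_density 1 t) * (\<integral>\<^sup>+j. f (t, j) \<partial>jump_pmf R) \<partial>lborel)"
proof -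
  have f: "f \<in> borel_measurable (density lborel (exponential_density 1) \<Otimes>\<^sub>M jump_pmf R)"
    using assms by (simp add: step_measure_def)
  have f' [measurable]: "(\<lambda>t. \<integral>\<^sup>+j. f (t, j) \<partial>jump_pmf R) \<in> borel_measurable borel"
    using measure_pmf.borel_measurable_nn_integral_fst[OF f] by simp
  show ?thesis
    unfolding step_measure_def measure_pmf.nn_integral_fst[OF f, symmetric]
    by (subst nn_integral_density) auto
qed

text \<open>An i.i.d. sequence is its first entry followed by an independent copy of the whole
  sequence.\<close>

lemma nn_integral_walk_space:
  assumes f [measurable]: "f \<in> borel_measurable (walk_space R)"
  shows "(\<integral>\<^sup>+\<omega>. f \<omega> \<partial>walk_space R) =
    (\<integral>\<^sup>+t. ennreal (exponential_density 1 t) *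
      (\<integral>\<^sup>+j. (\<integral>\<^sup>+\<omega>. f (case_nat (t, j) \<omega>) \<partial>walk_space R) \<partial>jump_pmf R) \<partial>lborel)"
proof -
  interpret W: prob_space "walk_space R :: (nat \<Rightarrow> real \<times> (int ^ 'a)) measure"
    by (rule prob_space_walk_space)
  interpret M: prob_space "step_measure R :: (real \<times> (int ^ 'a)) measure"
    by (rule prob_space_step_measure)
  interpret S: sequence_space "step_measure R :: (real \<times> (int ^ 'a)) measure" ..
  have "(\<integral>\<^sup>+\<omega>. f \<omega> \<partial>walk_space R) =
      (\<integral>\<^sup>+x. f (case x of (s, \<omega>) \<Rightarrow> case_nat s \<omega>) \<partial>(step_measure R \<Otimes>\<^sub>M walk_space R))"
    using f unfolding walk_space_eq
    by (subst S.PiM_iter[symmetric]) (simp add: nn_integral_distr)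
  also have "\<dots> = (\<integral>\<^sup>+s. \<integral>\<^sup>+\<omega>. f (case_nat s \<omega>) \<partial>walk_space R \<partial>step_measure R)"
    by (subst W.nn_integral_fst[symmetric]) simp_all
  also have "\<dots> = (\<integral>\<^sup>+t. ennreal (exponential_density 1 t) *
      (\<integral>\<^sup>+j. (\<integral>\<^sup>+\<omega>. f (case_nat (t, j) \<omega>) \<partial>walk_space R) \<partial>jump_pmf R) \<partial>lborel)"
    by (rule nn_integral_step_measure) measurable
  finally show ?thesis .
qed

text \<open>The meeting probability as an iterated integral of nonnegative functions, so that
  conditioning and exchanging the two walks raise no integrability questions.\<close>

definition regular_meeting_mass :: "nat \<Rightarrow> int ^ 'd::finite \<Rightarrow> int ^ 'd \<Rightarrow> ennreal" where
  "regular_meeting_mass R u v =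
    (\<integral>\<^sup>+\<omega>. \<integral>\<^sup>+\<omega>'. (if regular_meeting u v \<omega> \<omega>' then 1 else 0) \<partial>walk_space R \<partial>walk_space R)"

lemma exponential_density_add:
  assumes "0 \<le> t" "0 \<le> r"
  shows "exponential_density 1 (t + r) = exp (- t) * exponential_density 1 r"
  using assms by (simp add: exponential_density_def exp_add[symmetric])

text \<open>The value is the chance that a given one of two independent clocks of rate 1 rings
  first; \<open>exp (- t)\<close> is the probability that the other survives
  \<open>t\<close>.\<close>

lemma nn_integral_exponential_half:
  "(\<integral>\<^sup>+t. ennreal (exponential_density 1 t) * ennreal (exp (- t)) \<partial>lborel) = 1 / 2"
proof -
  have "(\<integral>\<^sup>+t. ennreal (exponential_density 1 t) * ennreal (exp (- t)) \<partial>lborel) =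
      (\<integral>\<^sup>+t. ennreal (1 / 2) * ennreal (exponential_density 2 t) \<partial>lborel)"
    by (intro nn_integral_cong)
       (auto simp: exponential_density_def ennreal_mult[symmetric] exp_add[symmetric] simp del: ennreal_half)
  also have "\<dots> = ennreal (1 / 2) * emeasure (density lborel (exponential_density 2)) UNIV"
    by (subst nn_integral_cmult) (auto simp: emeasure_density)
  also have "emeasure (density lborel (exponential_density 2)) UNIV = 1"
    using prob_space.emeasure_space_1[OF prob_space_exponential_density[of 2]] by simp
  finally show ?thesis by (simp add: divide_ennreal_def)
qed

text \<open>The loss-of-memory property of the exponential distribution is used on the event that the
  walk from \<open>u\<close> is the first to jump.\<close>

lemma first_step_ge:
  "1 / 2 * (\<integral>\<^sup>+j. regular_meeting_mass R (u + j) v \<partial>jump_pmf R) \<le>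
    (\<integral>\<^sup>+\<omega>. \<integral>\<^sup>+\<omega>'. (if regular_meeting u v \<omega> \<omega>' \<and> fst (\<omega> 0) < fst (\<omega>' 0) then 1 else 0)
      \<partial>walk_space R \<partial>walk_space R)" (is "_ \<le> ?rhs")
proof -
  interpret W: prob_space "walk_space R :: (nat \<Rightarrow> real \<times> (int ^ 'a)) measure"
    by (rule prob_space_walk_space)
  define g where "g = (\<lambda>\<omega>. \<integral>\<^sup>+\<omega>'. (if regular_meeting u v \<omega> \<omega>' \<and> fst (\<omega> 0) < fst (\<omega>' 0)
      then 1 else 0 :: ennreal) \<partial>walk_space R)"
  have [measurable]: "g \<in> borel_measurable (walk_space R)" unfolding g_def by measurable
  \<comment> \<open>The first step \<open>(t, j)\<close> of the walk from \<open>u\<close> is fixed.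
    The factor \<open>exp (- t)\<close> is the probability that the other clock exceeds
    \<open>t\<close>, and its residual time \<open>r\<close> is again exponential.\<close>
  have inner: "ennreal (exp (- t)) * (\<integral>\<^sup>+\<omega>'. (if regular_meeting (u + j) v \<omega> \<omega>' then 1 else 0) \<partial>walk_space R)
      \<le> g (case_nat (t, j) \<omega>)" if t: "0 \<le> t" and \<omega>: "\<omega> \<in> space (walk_space R)" for t j \<omega>
  proof -
    define h where "h r = (\<integral>\<^sup>+j'. \<integral>\<^sup>+\<omega>'. (if regular_meeting (u + j) v \<omega> (case_nat (r, j') \<omega>')
      then 1 else 0 :: ennreal) \<partial>walk_space R \<partial>jump_pmf R)" for r
    define h' where "h' s = (\<integral>\<^sup>+j'. \<integral>\<^sup>+\<omega>'. (if regular_meeting u v (case_nat (t, j) \<omega>) (case_nat (s, j') \<omega>')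
      \<and> t < s then 1 else 0 :: ennreal) \<partial>walk_space R \<partial>jump_pmf R)" for s
    have [measurable]: "h \<in> borel_measurable borel" "h' \<in> borel_measurable borel"
      using \<omega> unfolding h_def h'_def by measurable
    have "ennreal (exp (- t)) * (\<integral>\<^sup>+\<omega>'. (if regular_meeting (u + j) v \<omega> \<omega>' then 1 else 0) \<partial>walk_space R)
        = ennreal (exp (- t)) * (\<integral>\<^sup>+r. ennreal (exponential_density 1 r) * h r \<partial>lborel)"
      using \<omega> unfolding h_def by (subst nn_integral_walk_space) simp_all
    also have "\<dots> = (\<integral>\<^sup>+r. ennreal (exp (- t)) * (ennreal (exponential_density 1 r) * h r) \<partial>lborel)"
      by (rule nn_integral_cmult[symmetric]) simp
    also have "\<dots> \<le> (\<integral>\<^sup>+r. ennreal (exponential_density 1 (t + r)) * h' (t + r) \<partial>lborel)"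
    proof (rule nn_integral_mono_AE)
      \<comment> \<open>At \<open>r = 0\<close> the density is positive but the strict condition
        \<open>t < s\<close> fails for \<open>s = t + r\<close>; this single point is null.\<close>
      have "AE r in lborel. r \<noteq> (0 :: real)" by (rule AE_lborel_singleton)
      then show "AE r in lborel. ennreal (exp (- t)) * (ennreal (exponential_density 1 r) * h r)
          \<le> ennreal (exponential_density 1 (t + r)) * h' (t + r)"
      proof eventually_elim
        case (elim r)
        show ?case
        proof (cases "0 < r")
          case True
          have "h r \<le> h' (t + r)"
            unfolding h_def h'_def using True t
            by (intro nn_integral_mono) (auto intro: regular_meeting_step)
          then show ?thesis
            using t True
            by (auto simp: exponential_density_add ennreal_mult mult.assoc
                intro!: mult_left_mono)
        next
          case False
          with elim show ?thesis by (simp add: exponential_density_def)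
        qed
      qed
    qed
    \<comment> \<open>Substitution \<open>s = t + r\<close>: the residual time becomes the full
      first holding time of the second walk.\<close>
    also have "\<dots> = (\<integral>\<^sup>+s. ennreal (exponential_density 1 s) * h' s \<partial>lborel)"
      by (subst nn_integral_real_affine[where c = 1 and t = t]) simp_all
    also have "\<dots> = g (case_nat (t, j) \<omega>)"
      using \<omega> unfolding h'_def g_def by (subst (2) nn_integral_walk_space) simp_all
    finally show ?thesis .
  qed
  have "1 / 2 * (\<integral>\<^sup>+j. regular_meeting_mass R (u + j) v \<partial>jump_pmf R) =
      (\<integral>\<^sup>+t. ennreal (exponential_density 1 t) * ennreal (exp (- t)) *
        (\<integral>\<^sup>+j. regular_meeting_mass R (u + j) v \<partial>jump_pmf R) \<partial>lborel)"
    by (subst nn_integral_multc) (simp_all add: nn_integral_exponential_half)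
  also have "\<dots> \<le> (\<integral>\<^sup>+t. ennreal (exponential_density 1 t) *
      (\<integral>\<^sup>+j. (\<integral>\<^sup>+\<omega>. g (case_nat (t, j) \<omega>) \<partial>walk_space R) \<partial>jump_pmf R) \<partial>lborel)"
  proof (rule nn_integral_mono)
    fix t :: real
    show "ennreal (exponential_density 1 t) * ennreal (exp (- t)) *
        (\<integral>\<^sup>+j. regular_meeting_mass R (u + j) v \<partial>jump_pmf R) \<le>
        ennreal (exponential_density 1 t) *
          (\<integral>\<^sup>+j. (\<integral>\<^sup>+\<omega>. g (case_nat (t, j) \<omega>) \<partial>walk_space R) \<partial>jump_pmf R)"
    proof (cases "0 \<le> t")
      case True
      have "ennreal (exp (- t)) * regular_meeting_mass R (u + j) v
          \<le> (\<integral>\<^sup>+\<omega>. g (case_nat (t, j) \<omega>) \<partial>walk_space R)" for j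
        unfolding regular_meeting_mass_def
        by (subst nn_integral_cmult[symmetric]) (auto intro!: nn_integral_mono inner[OF True])
      then have "ennreal (exp (- t)) * (\<integral>\<^sup>+j. regular_meeting_mass R (u + j) v \<partial>jump_pmf R)
          \<le> (\<integral>\<^sup>+j. (\<integral>\<^sup>+\<omega>. g (case_nat (t, j) \<omega>) \<partial>walk_space R) \<partial>jump_pmf R)"
        by (subst nn_integral_cmult[symmetric]) (auto intro!: nn_integral_mono)
      then show ?thesis unfolding mult.assoc by (rule mult_left_mono) simp
    qed (simp add: exponential_density_def)
  qed
  also have "\<dots> = ?rhs"
    unfolding g_def[symmetric] by (rule nn_integral_walk_space[symmetric]) simp
  finally show ?thesis .
qed

lemma regular_meeting_mass_commute: "regular_meeting_mass R u v = regular_meeting_mass R v u"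
proof -
  interpret W: prob_space "walk_space R :: (nat \<Rightarrow> real \<times> (int ^ 'a)) measure"
    by (rule prob_space_walk_space)
  interpret P: pair_prob_space "walk_space R :: (nat \<Rightarrow> real \<times> (int ^ 'a)) measure"
    "walk_space R :: (nat \<Rightarrow> real \<times> (int ^ 'a)) measure" ..
  show ?thesis
    unfolding regular_meeting_mass_def
    by (subst P.Fubini') (simp_all add: regular_meeting_commute[of u v])
qed

text \<open>The events that the walk from \<open>u\<close>, or the one from \<open>v\<close>, jumps
  strictly first are disjoint, so their contributions add up within the meeting event. Ties are
  simply discarded. Fubini puts both contributions on the same pair of walks.\<close>

lemma regular_meeting_mass_ge:
  "1 / 2 * (\<integral>\<^sup>+j. regular_meeting_mass R (u + j) v \<partial>jump_pmf R) +
   1 / 2 * (\<integral>\<^sup>+j. regular_meeting_mass R (v + j) u \<partial>jump_pmf R) \<le> regular_meeting_mass R u v"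
proof -
  interpret W: prob_space "walk_space R :: (nat \<Rightarrow> real \<times> (int ^ 'a)) measure"
    by (rule prob_space_walk_space)
  interpret P: pair_prob_space "walk_space R :: (nat \<Rightarrow> real \<times> (int ^ 'a)) measure"
    "walk_space R :: (nat \<Rightarrow> real \<times> (int ^ 'a)) measure" ..
  define I where "I u v \<omega> \<omega>' =
    (if regular_meeting u v \<omega> \<omega>' \<and> fst (\<omega> 0) < fst (\<omega>' 0) then 1 else 0 :: ennreal)"
    for u v :: "int ^ 'a" and \<omega> \<omega>'
  have [measurable]: "(\<lambda>x. I u v (fst x) (snd x)) \<in> borel_measurable (walk_space R \<Otimes>\<^sub>M walk_space R)"
    "(\<lambda>x. I u v (snd x) (fst x)) \<in> borel_measurable (walk_space R \<Otimes>\<^sub>M walk_space R)" for u v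
    unfolding I_def by measurable
  have "1 / 2 * (\<integral>\<^sup>+j. regular_meeting_mass R (u + j) v \<partial>jump_pmf R) +
      1 / 2 * (\<integral>\<^sup>+j. regular_meeting_mass R (v + j) u \<partial>jump_pmf R) \<le>
      (\<integral>\<^sup>+\<omega>. \<integral>\<^sup>+\<omega>'. I u v \<omega> \<omega>' \<partial>walk_space R \<partial>walk_space R) +
      (\<integral>\<^sup>+\<omega>. \<integral>\<^sup>+\<omega>'. I v u \<omega> \<omega>' \<partial>walk_space R \<partial>walk_space R)"
    unfolding I_def by (intro add_mono first_step_ge)
  also have "(\<integral>\<^sup>+\<omega>. \<integral>\<^sup>+\<omega>'. I v u \<omega> \<omega>' \<partial>walk_space R \<partial>walk_space R) =
      (\<integral>\<^sup>+\<omega>. \<integral>\<^sup>+\<omega>'. I v u \<omega>' \<omega> \<partial>walk_space R \<partial>walk_space R)"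
    by (subst P.Fubini') (simp_all add: split_beta')
  also have "(\<integral>\<^sup>+\<omega>. \<integral>\<^sup>+\<omega>'. I u v \<omega> \<omega>' \<partial>walk_space R \<partial>walk_space R) + \<dots> =
      (\<integral>\<^sup>+\<omega>. \<integral>\<^sup>+\<omega>'. I u v \<omega> \<omega>' + I v u \<omega>' \<omega> \<partial>walk_space R \<partial>walk_space R)"
  proof (subst nn_integral_add[symmetric])
    have [measurable]: "I u v \<omega> \<in> borel_measurable (walk_space R)"
      "(\<lambda>\<omega>'. I v u \<omega>' \<omega>) \<in> borel_measurable (walk_space R)" if "\<omega> \<in> space (walk_space R)" for \<omega>
      using that unfolding I_def by measurable
    show "(\<integral>\<^sup>+\<omega>. (\<integral>\<^sup>+\<omega>'. I u v \<omega> \<omega>' \<partial>walk_space R) + (\<integral>\<^sup>+\<omega>'. I v u \<omega>' \<omega> \<partial>walk_space R) \<partial>walk_space R) =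
        (\<integral>\<^sup>+\<omega>. \<integral>\<^sup>+\<omega>'. I u v \<omega> \<omega>' + I v u \<omega>' \<omega> \<partial>walk_space R \<partial>walk_space R)"
      by (intro nn_integral_cong nn_integral_add[symmetric]) simp_all
  qed measurable
  also have "\<dots> \<le> regular_meeting_mass R u v"
    unfolding regular_meeting_mass_def
    by (intro nn_integral_mono) (auto simp: I_def regular_meeting_commute[of v u])
  finally show ?thesis .
qed

section \<open>The jump set and its symmetry\<close>

lemma l1_norm_minus: "l1_norm (- x) = l1_norm x"
  by (simp add: l1_norm_def)

lemma l1_norm_pos_iff: "0 < l1_norm x \<longleftrightarrow> x \<noteq> 0"
proof -
  have "l1_norm x = 0 \<longleftrightarrow> x = 0"
    by (simp add: l1_norm_def sum_nonneg_eq_0_iff vec_eq_iff)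
  moreover have "0 \<le> l1_norm x" by (simp add: l1_norm_def sum_nonneg)
  ultimately show ?thesis by linarith
qed

lemma minus_in_B1_iff: "- x \<in> B1 R \<longleftrightarrow> x \<in> B1 R"
  by (simp add: B1_def l1_norm_minus)

lemma finite_B1: "finite (B1 R :: (int ^ 'd::finite) set)"
proof -
  have "B1 R \<subseteq> (\<lambda>f. \<chi> i. f i) ` (UNIV \<rightarrow>\<^sub>E {- int R..int R} :: ('d \<Rightarrow> int) set)"
  proof
    fix x :: "int ^ 'd" assume "x \<in> B1 R"
    then have sum: "(\<Sum>i\<in>UNIV. \<bar>x $ i\<bar>) \<le> int R" by (simp add: B1_def l1_norm_def)
    have "\<bar>x $ i\<bar> \<le> (\<Sum>i\<in>UNIV. \<bar>x $ i\<bar>)" for i by (rule member_le_sum) auto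
    then have "\<bar>x $ i\<bar> \<le> int R" for i using sum order.trans by blast
    then have "($) x \<in> UNIV \<rightarrow>\<^sub>E {- int R..int R}" by (auto simp: abs_le_iff minus_le_iff)
    then show "x \<in> (\<lambda>f. \<chi> i. f i) ` (UNIV \<rightarrow>\<^sub>E {- int R..int R})"
      by (intro image_eqI[of _ _ "($) x"]) (simp_all add: vec_eq_iff)
  qed
  then show ?thesis by (rule finite_subset) (intro finite_imageI finite_PiE, auto)
qed

lemma zero_in_B1: "0 \<in> B1 R"
  by (simp add: B1_def l1_norm_def)

lemma B1_nontrivial:
  assumes "0 < R"
  shows "B1 R - {0} \<noteq> ({} :: (int ^ 'd::finite) set)"
proof -
  obtain i :: 'd where True by simp
  have "l1_norm (axis i 1 :: int ^ 'd) = (\<Sum>j\<in>UNIV. if j = i then 1 else 0)"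
    unfolding l1_norm_def by (intro sum.cong) (auto simp: axis_def)
  then have "axis i 1 \<in> (B1 R :: (int ^ 'd) set)" using assms by (simp add: B1_def)
  moreover have "axis i 1 \<noteq> (0 :: int ^ 'd)" by (simp add: vec_eq_iff axis_def)
  ultimately show ?thesis by blast
qed

lemma card_B1: "real (card (B1 R :: (int ^ 'd::finite) set)) - 1 = real (card (B1 R - {0} :: (int ^ 'd) set))"
proof -
  have "Suc (card (B1 R - {0} :: (int ^ 'd) set)) = card (B1 R :: (int ^ 'd) set)"
    by (rule card_Suc_Diff1[OF finite_B1 zero_in_B1])
  then show ?thesis by linarith
qed

section \<open>Symmetry, diagonal value and superharmonicity of the meeting weight\<close>

lemma regular_meeting_mass_eq: "regular_meeting_mass R u v = ennreal (regular_meeting_prob R u v)"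
proof -
  interpret W: prob_space "walk_space R :: (nat \<Rightarrow> real \<times> (int ^ 'a)) measure"
    by (rule prob_space_walk_space)
  interpret P: pair_prob_space "walk_space R :: (nat \<Rightarrow> real \<times> (int ^ 'a)) measure"
    "walk_space R :: (nat \<Rightarrow> real \<times> (int ^ 'a)) measure" ..
  let ?E = "{(\<omega>, \<omega>'). regular_meeting u v \<omega> \<omega>'}"
  have "?E = {x \<in> space (walk_space R \<Otimes>\<^sub>M walk_space R). regular_meeting u v (fst x) (snd x)}"
    by (auto simp: space_pair_measure)
  then have "?E \<in> sets (walk_space R \<Otimes>\<^sub>M walk_space R)" by simp
  then have "(\<integral>\<^sup>+x. indicator ?E x \<partial>(walk_space R \<Otimes>\<^sub>M walk_space R)) =
      emeasure (walk_space R \<Otimes>\<^sub>M walk_space R) ?E" by simp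
  also have "(\<integral>\<^sup>+x. indicator ?E x \<partial>(walk_space R \<Otimes>\<^sub>M walk_space R)) = regular_meeting_mass R u v"
    unfolding regular_meeting_mass_def using \<open>?E \<in> _\<close>
    by (subst W.nn_integral_fst[symmetric]) (auto intro!: nn_integral_cong simp: indicator_def)
  finally show ?thesis by (simp add: regular_meeting_prob_def P.P.emeasure_eq_measure)
qed

lemma regular_meeting_prob_nonneg: "0 \<le> regular_meeting_prob R u v"
  by (simp add: regular_meeting_prob_def)

lemma regular_meeting_prob_commute: "regular_meeting_prob R u v = regular_meeting_prob R v u"
  using regular_meeting_mass_commute[of R u v]
  by (simp add: regular_meeting_mass_eq regular_meeting_prob_nonneg)

lemma regular_meeting_prob_translate:
  "regular_meeting_prob R (u + z) (v + z) = regular_meeting_prob R u v"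
proof -
  have "regular_meeting (u + z) (v + z) \<omega> \<omega>' \<longleftrightarrow> regular_meeting u v \<omega> \<omega>'" for \<omega> \<omega>'
  proof -
    have "u + z + a = v + z + b \<longleftrightarrow> u + a = v + b" for a b
    proof -
      have "u + z + a = z + (u + a)" "v + z + b = z + (v + b)" by (simp_all add: ac_simps)
      then show ?thesis by simp
    qed
    then show ?thesis by (simp add: regular_meeting_def)
  qed
  then show ?thesis by (simp add: regular_meeting_prob_def)
qed

text \<open>Holding times are almost surely positive, so the two initial holding intervals overlap
  and indices \<open>n = k = 0\<close> witness the meeting.\<close>

lemma regular_meeting_prob_refl: "regular_meeting_prob R u u = 1"
proof -
  interpret W: prob_space "walk_space R :: (nat \<Rightarrow> real \<times> (int ^ 'a)) measure"
    by (rule prob_space_walk_space)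
  have "(\<integral>\<^sup>+s. indicator {s. \<not> 0 < fst s} s \<partial>(step_measure R :: (real \<times> (int ^ 'a)) measure)) =
      (\<integral>\<^sup>+t. 0 \<partial>(lborel :: real measure))"
  proof (subst nn_integral_step_measure)
    show "(\<integral>\<^sup>+t. ennreal (exponential_density 1 t) *
        (\<integral>\<^sup>+j. indicator {s. \<not> 0 < fst s} (t, j) \<partial>(jump_pmf R :: (int ^ 'a) pmf)) \<partial>lborel) = (\<integral>\<^sup>+t. 0 \<partial>(lborel :: real measure))"
    proof (rule nn_integral_cong_AE)
      have "AE t in lborel. t \<noteq> (0 :: real)" by (rule AE_lborel_singleton)
      then show "AE t in lborel. ennreal (exponential_density 1 t) *
        (\<integral>\<^sup>+j. indicator {s. \<not> 0 < fst s} (t, j) \<partial>(jump_pmf R :: (int ^ 'a) pmf)) = 0"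
        by eventually_elim (auto simp: exponential_density_def indicator_def)
    qed
  qed measurable
  then have "AE s in (step_measure R :: (real \<times> (int ^ 'a)) measure). 0 < fst s"
    by (subst AE_iff_nn_integral, measurable)
  then have "AE \<omega> in (walk_space R :: (nat \<Rightarrow> real \<times> (int ^ 'a)) measure). 0 < fst (\<omega> k)" for k
    unfolding walk_space_eq
    by (intro AE_PiM_component[where P = "\<lambda>s. 0 < fst s"] prob_space_step_measure) simp_all
  then have pos: "AE \<omega> in (walk_space R :: (nat \<Rightarrow> real \<times> (int ^ 'a)) measure). \<forall>k. 0 < fst (\<omega> k)"
    by (simp add: AE_all_countable)
  have regular: "regular_meeting u u \<omega> \<omega>'" if "\<forall>k. 0 < fst (\<omega> k)" "\<forall>k. 0 < fst (\<omega>' k)" for \<omega> \<omega>'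
    unfolding regular_meeting_def using that
    by (auto simp: elapsed_def displacement_def less_imp_le intro!: exI[of _ 0])
  have "(\<integral>\<^sup>+\<omega>'. (if regular_meeting u u \<omega> \<omega>' then 1 else 0) \<partial>walk_space R) = (1 :: ennreal)"
    if "\<forall>k. 0 < fst (\<omega> k)" for \<omega>
  proof -
    have "(\<integral>\<^sup>+\<omega>'. (if regular_meeting u u \<omega> \<omega>' then 1 else 0) \<partial>walk_space R) =
        (\<integral>\<^sup>+\<omega>'. 1 \<partial>(walk_space R :: (nat \<Rightarrow> real \<times> (int ^ 'a)) measure))"
      by (rule nn_integral_cong_AE) (use pos in \<open>eventually_elim, use regular that in auto\<close>)
    then show ?thesis using W.emeasure_space_1 by simp
  qed
  then have "regular_meeting_mass R u u = (\<integral>\<^sup>+\<omega>. 1 \<partial>(walk_space R :: (nat \<Rightarrow> real \<times> (int ^ 'a)) measure))"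
    unfolding regular_meeting_mass_def
    by (intro nn_integral_cong_AE) (use pos in \<open>eventually_elim, auto\<close>)
  then show ?thesis using W.emeasure_space_1 by (simp add: regular_meeting_mass_eq)
qed

text \<open>A jump \<open>w\<close> of the walk from \<open>v\<close> changes the difference of the
  walks as a jump \<open>- w\<close> of the walk from \<open>u\<close> does, and the jump set is
  symmetric. The two halves of the first-step inequality therefore agree, which turns a statement on
  the pair into superharmonicity in one argument.\<close>

lemma regular_meeting_prob_superharmonic:
  fixes u v :: "int ^ 'd::finite"
  assumes "0 < R"
  shows "(\<Sum>w\<in>B1 R - {0}. regular_meeting_prob R (u + w) v)
    \<le> card (B1 R - {0} :: (int ^ 'd) set) * regular_meeting_prob R u v"
proof -
  let ?J = "B1 R - {0} :: (int ^ 'd) set" and ?p = "regular_meeting_prob R"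
  have J: "finite ?J" "?J \<noteq> {}" using finite_B1 B1_nontrivial[OF assms] by auto
  have "?p (v + w) u = ?p (u + - w) v" for w
    using regular_meeting_prob_translate[of R u w "v"] regular_meeting_prob_translate[of R "u + - w" w v]
    by (simp add: regular_meeting_prob_commute[of R "v + w"])
  then have "(\<Sum>w\<in>?J. ?p (v + w) u) = (\<Sum>w\<in>?J. ?p (u + - w) v)" by simp
  also have "\<dots> = (\<Sum>w\<in>?J. ?p (u + w) v)"
    by (rule sum.reindex_bij_witness[of _ uminus uminus]) (auto simp: minus_in_B1_iff)
  finally have eq: "(\<Sum>w\<in>?J. ?p (v + w) u) = (\<Sum>w\<in>?J. ?p (u + w) v)" .
  have avg: "(\<integral>\<^sup>+j. regular_meeting_mass R (u + j) v \<partial>jump_pmf R) =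
      ennreal ((\<Sum>w\<in>?J. ?p (u + w) v) / card ?J)" for u v
  proof -
    have "(\<integral>\<^sup>+j. regular_meeting_mass R (u + j) v \<partial>jump_pmf R) =
        ennreal (\<Sum>w\<in>?J. ?p (u + w) v) / ennreal (card ?J)"
      using J by (simp add: nn_integral_pmf_of_set regular_meeting_mass_eq sum_ennreal
          regular_meeting_prob_nonneg ennreal_of_nat_eq_real_of_nat)
    also have "\<dots> = ennreal ((\<Sum>w\<in>?J. ?p (u + w) v) / card ?J)"
      using J by (intro divide_ennreal sum_nonneg regular_meeting_prob_nonneg) (simp add: card_gt_0_iff)
    finally show ?thesis .
  qed
  have half: "1 / 2 * ennreal x + 1 / 2 * ennreal x = ennreal x" if "0 \<le> x" for x
  proof -
    have "1 / 2 * ennreal x = ennreal (x / 2)"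
      using that by (simp add: divide_ennreal_def mult.commute ennreal_divide_numeral[symmetric])
    then show ?thesis using that by (simp add: ennreal_plus[symmetric] del: ennreal_plus)
  qed
  have "0 \<le> (\<Sum>w\<in>?J. ?p (u + w) v) / card ?J"
    by (intro divide_nonneg_nonneg sum_nonneg regular_meeting_prob_nonneg) simp
  from half[OF this] have "ennreal ((\<Sum>w\<in>?J. ?p (u + w) v) / card ?J) \<le> regular_meeting_mass R u v"
    using regular_meeting_mass_ge[of R u v] unfolding avg eq by simp
  then have "(\<Sum>w\<in>?J. ?p (u + w) v) / card ?J \<le> ?p u v"
    by (simp add: regular_meeting_mass_eq regular_meeting_prob_nonneg)
  then show ?thesis using J by (simp add: field_simps card_gt_0_iff)
qed

section \<open>The maximum principle and the evolution equation\<close>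

text \<open>A Gronwall estimate without derivatives: forward increments are controlled uniformly in
  \<open>t\<close>, so an Euler scheme with \<open>m\<close> equal steps applies, and
  \<open>(1 - \<Lambda> * T / m) ^ m\<close> tends to the exponential while the errors total
  \<open>T * e\<close>.\<close>

lemma exponential_lower_bound:
  fixes X :: "real \<Rightarrow> real"
  assumes "0 \<le> \<Lambda>" "0 \<le> T"
    and step: "\<And>e. 0 < e \<Longrightarrow> \<exists>\<delta>>0. \<forall>t\<ge>0. \<forall>s>0. s < \<delta> \<longrightarrow> t + s \<le> T \<longrightarrow> (1 - \<Lambda> * s) * X t - s * e \<le> X (t + s)"
  shows "exp (- \<Lambda> * T) * X 0 \<le> X T"
proof (cases "T = 0")
  case False
  with assms have T: "0 < T" by simp
  have "exp (- \<Lambda> * T) * X 0 - T * e \<le> X T" if e: "0 < e" for e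
  proof -
    obtain \<delta> where \<delta>: "0 < \<delta>" and step:
      "\<And>t s. 0 \<le> t \<Longrightarrow> 0 < s \<Longrightarrow> s < \<delta> \<Longrightarrow> t + s \<le> T \<Longrightarrow> (1 - \<Lambda> * s) * X t - s * e \<le> X (t + s)"
      using step[OF e] by blast
    \<comment> \<open>The first condition on \<open>m\<close> makes the step shorter than \<delta>;
      the second keeps \<open>1 - \<Lambda> * s\<close> positive, so that inequalities may be
      multiplied by it.\<close>
    have "(1 + (- \<Lambda> * T) / m) ^ m * X 0 - T * e \<le> X T" if m: "T / \<delta> < real m" "\<Lambda> * T < real m" for m
    proof -
      have m0: "0 < real m" using m T \<delta> by (meson divide_pos_pos order.strict_trans)
      define s where "s = T / m"
      have s: "0 < s" "s < \<delta>" "\<Lambda> * s < 1"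
        using m m0 T \<delta> by (simp_all add: s_def field_simps)
      have q: "0 \<le> 1 - \<Lambda> * s" "1 - \<Lambda> * s \<le> 1" using s \<open>0 \<le> \<Lambda>\<close> by simp_all
      have "(1 - \<Lambda> * s) ^ k * X 0 - k * s * e \<le> X (k * s)" if "k \<le> m" for k
        using that
      proof (induction k)
        case (Suc k)
        have "real (Suc k) * s \<le> real m * s" using Suc.prems s by (intro mult_right_mono) auto
        also have "\<dots> = T" using m0 by (simp add: s_def)
        finally have "real (Suc k) * s \<le> T" .
        then have "(1 - \<Lambda> * s) * X (k * s) - s * e \<le> X (k * s + s)"
          using s by (intro step) (auto simp: algebra_simps)
        moreover have "(1 - \<Lambda> * s) * ((1 - \<Lambda> * s) ^ k * X 0 - k * s * e) \<le> (1 - \<Lambda> * s) * X (k * s)"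
          using Suc q by (intro mult_left_mono) auto
        moreover have "(1 - \<Lambda> * s) * (k * s * e) \<le> 1 * (k * s * e)"
          using q s e by (intro mult_right_mono) auto
        ultimately show ?case by (simp add: algebra_simps)
      qed simp
      from this[of m] m0 show ?thesis by (simp add: s_def)
    qed
    note large = this
    obtain N where N: "max (T / \<delta>) (\<Lambda> * T) < real N" using reals_Archimedean2 by blast
    have ev: "eventually (\<lambda>m. (1 + (- \<Lambda> * T) / m) ^ m * X 0 - T * e \<le> X T) sequentially"
      using eventually_ge_at_top[of N]
    proof eventually_elim
      case (elim m)
      then have "real N \<le> real m" by simp
      with N show ?case by (intro large) linarith+
    qed
    have "(\<lambda>m. (1 + (- \<Lambda> * T) / m) ^ m * X 0 - T * e) \<longlonglongrightarrow> exp (- \<Lambda> * T) * X 0 - T * e"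
      by (intro tendsto_intros tendsto_exp_limit_sequentially)
    then show ?thesis using ev by (rule tendsto_upperbound) simp
  qed
  note approx = this
  show ?thesis
  proof (rule field_le_epsilon)
    fix e :: real assume "0 < e"
    with approx[of "e / T"] T show "exp (- \<Lambda> * T) * X 0 \<le> X T + e" by simp
  qed
qed simp

text \<open>A bounded lower estimate \<open>- C\<close> of \<open>V - U\<close> on \<open>[0, T]\<close> improves itself by the factor
  \<open>1 - exp (- \<Lambda> T)\<close>.\<close>

lemma jump_process_comparison:
  fixes U :: "real \<Rightarrow> 's \<Rightarrow> real" and V :: "'s \<Rightarrow> real"
    and I :: "'s \<Rightarrow> 'i set" and m :: "'s \<Rightarrow> 'i \<Rightarrow> 's" and r :: real
  assumes fin: "\<And>y. finite (I y)" and r: "0 \<le> r" "\<And>y. r * card (I y) \<le> \<Lambda>"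
    and bound: "\<And>t y. 0 \<le> t \<Longrightarrow> U t y \<le> V y + C0" and "0 \<le> C0"
    and init: "\<And>y. U 0 y \<le> V y"
    and super: "\<And>y. (\<Sum>i\<in>I y. V (m y i) - V y) \<le> 0"
    and expand: "\<And>y e. 0 < e \<Longrightarrow> \<exists>\<delta>>0. \<forall>t\<ge>0. \<forall>s>0. s < \<delta> \<longrightarrow>
      U (t + s) y \<le> U t y + s * (r * (\<Sum>i\<in>I y. U t (m y i) - U t y)) + s * e"
    and T: "0 \<le> T"
  shows "U T y \<le> V y"
proof -
  have "0 \<le> r * card (I y)" using r(1) by simp
  then have \<Lambda>: "0 \<le> \<Lambda>" using r(2)[of y] by linarith
  \<comment> \<open>The factor is the same for all states because \<Lambda> bounds every total jump
    rate. The improvement is thus uniform over an infinite state space, with no need for a maximum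
    to be attained.\<close>
  define q where "q = 1 - exp (- \<Lambda> * T)"
  have q: "0 \<le> q" "q < 1" using \<Lambda> T by (auto simp: q_def)
  have improve: "\<forall>t\<in>{0..T}. \<forall>y. U t y \<le> V y + q * C"
    if C: "0 \<le> C" "\<forall>t\<in>{0..T}. \<forall>y. U t y \<le> V y + C" for C
  proof (intro ballI allI)
    fix t0 y assume t0: "t0 \<in> {0..T}"
    define X where "X t = V y - U t y + C" for t
    have "exp (- \<Lambda> * t0) * X 0 \<le> X t0"
    proof (rule exponential_lower_bound[OF \<Lambda>])
      fix e :: real assume "0 < e"
      then obtain \<delta> where \<delta>: "\<delta> > 0" "\<And>t s. 0 \<le> t \<Longrightarrow> 0 < s \<Longrightarrow> s < \<delta> \<Longrightarrow>
          U (t + s) y \<le> U t y + s * (r * (\<Sum>i\<in>I y. U t (m y i) - U t y)) + s * e"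
        using expand by metis
      have "(1 - \<Lambda> * s) * X t - s * e \<le> X (t + s)" if ts: "0 \<le> t" "0 < s" "s < \<delta>" "t + s \<le> t0" for t s
      proof -
        have t: "t \<in> {0..T}" using ts t0 by auto
        have "U t y \<le> V y + C" using C(2) t by blast
        then have X0: "0 \<le> X t" by (simp add: X_def)
        \<comment> \<open>Each \<open>U t (m y i)\<close> is at most \<open>V (m y i) + C\<close>,
          and \<open>V y + C - U t y\<close> is \<open>X t\<close>; superharmonicity of
          \<open>V\<close> then removes the differences of \<open>V\<close>.\<close>
        have "(\<Sum>i\<in>I y. U t (m y i) - U t y) \<le>
            (\<Sum>i\<in>I y. X t + (V (m y i) - V y))"
          using C(2) t by (intro sum_mono) (simp add: X_def algebra_simps)
        also have "\<dots> \<le> card (I y) * X t"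
          using super[of y] by (simp add: sum.distrib)
        finally have "r * (\<Sum>i\<in>I y. U t (m y i) - U t y) \<le> r * (card (I y) * X t)"
          using r(1) by (rule mult_left_mono)
        also have "\<dots> \<le> \<Lambda> * X t"
          using mult_right_mono[OF r(2)[of y] X0] by (simp add: mult.assoc)
        finally have "s * (r * (\<Sum>i\<in>I y. U t (m y i) - U t y)) \<le> s * (\<Lambda> * X t)"
          using ts by (intro mult_left_mono) auto
        with \<delta>(2)[OF ts(1-3)] show ?thesis by (simp add: X_def algebra_simps)
      qed
      with \<delta>(1) show "\<exists>\<delta>>0. \<forall>t\<ge>0. \<forall>s>0. s < \<delta> \<longrightarrow> t + s \<le> t0 \<longrightarrow> (1 - \<Lambda> * s) * X t - s * e \<le> X (t + s)"
        by blast
    qed (use t0 in auto)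
    \<comment> \<open>\<open>X 0\<close> is at least \<open>C\<close> because \<open>U\<close>
      starts below \<open>V\<close>. At least \<open>exp (- \<Lambda> * T) * C\<close> of it
      survives, which lowers the permitted excess of \<open>U\<close> to
      \<open>q * C\<close>.\<close>
    moreover have "exp (- \<Lambda> * T) * C \<le> exp (- \<Lambda> * t0) * X 0"
      using t0 \<Lambda> C(1) init[of y] by (intro mult_mono) (auto simp: X_def mult_left_mono)
    ultimately show "U t0 y \<le> V y + q * C" by (simp add: X_def q_def algebra_simps)
  qed
  have "\<forall>t\<in>{0..T}. \<forall>y. U t y \<le> V y + q ^ k * C0" for k
  proof (induction k)
    case (Suc k)
    then show ?case using improve[of "q ^ k * C0"] q \<open>0 \<le> C0\<close> by (simp add: mult.assoc)
  qed (use bound in simp)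
  then have "U T y \<le> V y + q ^ k * C0" for k using T by simp
  moreover have "(\<lambda>k. V y + q ^ k * C0) \<longlonglongrightarrow> V y + 0 * C0"
    using q by (intro tendsto_intros LIMSEQ_power_zero) simp
  ultimately show ?thesis by (intro LIMSEQ_le_const[of "\<lambda>k. V y + q ^ k * C0"]) auto
qed

section \<open>Duality and the evolution of the voter law\<close>

text \<open>The pair consists of a site and a displacement. All labels at the site move together, so
  labels that have met never separate: this is the coalescing dynamics.\<close>

definition relocate :: "('a \<Rightarrow> 'b::plus) \<Rightarrow> 'b \<times> 'b \<Rightarrow> 'a \<Rightarrow> 'b" where
  "relocate y p a = (if y a = fst p then fst p + snd p else y a)"

definition determined_by :: "'a set \<Rightarrow> ('a \<Rightarrow> bool) set \<Rightarrow> bool" where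
  "determined_by A G \<longleftrightarrow> (\<forall>\<xi> \<eta>. (\<forall>a\<in>A. \<xi> a = \<eta> a) \<longrightarrow> \<xi> \<in> G \<longleftrightarrow> \<eta> \<in> G)"

lemma determined_byD: "determined_by A G \<Longrightarrow> (\<And>a. a \<in> A \<Longrightarrow> \<xi> a = \<eta> a) \<Longrightarrow> \<xi> \<in> G \<longleftrightarrow> \<eta> \<in> G"
  unfolding determined_by_def by blast

lemma space_config_space [simp]: "space config_space = UNIV"
  by (simp add: config_space_def space_PiM)

lemma determined_by_measurable:
  fixes G :: "'d::finite config set"
  assumes "finite A" "determined_by A G"
  shows "G \<in> sets config_space"
proof -
  have [measurable]: "(\<lambda>\<xi>. \<xi> a) \<in> config_space \<rightarrow>\<^sub>M count_space UNIV" for a :: "int ^ 'd"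
    unfolding config_space_def by measurable
  have "G = (\<Union>\<eta>\<in>(\<lambda>\<eta>. restrict \<eta> A) ` G. {\<xi> \<in> space config_space. \<forall>a\<in>A. \<xi> a = \<eta> a})"
  proof (intro equalityI subsetI)
    fix \<xi> assume "\<xi> \<in> (\<Union>\<eta>\<in>(\<lambda>\<eta>. restrict \<eta> A) ` G. {\<xi> \<in> space config_space. \<forall>a\<in>A. \<xi> a = \<eta> a})"
    then obtain \<eta> where "\<eta> \<in> G" "\<forall>a\<in>A. \<xi> a = \<eta> a" by auto
    then show "\<xi> \<in> G" using determined_byD[OF assms(2), of \<xi> \<eta>] by simp
  qed auto
  also have "\<dots> \<in> sets config_space"
  proof (rule sets.finite_UN)
    have "(\<lambda>\<eta>. restrict \<eta> A) ` G \<subseteq> A \<rightarrow>\<^sub>E UNIV" by auto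
    then show "finite ((\<lambda>\<eta>. restrict \<eta> A) ` G)"
      by (rule finite_subset) (intro finite_PiE assms, simp)
    show "{\<xi> \<in> space config_space. \<forall>a\<in>A. \<xi> a = \<eta> a} \<in> sets config_space" for \<eta>
      using assms(1) by measurable
  qed
  finally show ?thesis .
qed

lemma determined_by_vimage:
  assumes "determined_by A G"
  shows "determined_by (y ` A) {\<xi>. \<xi> \<circ> y \<in> G}"
  using assms unfolding determined_by_def by simp

text \<open>Duality for a single update: copying the value at \<open>z + w\<close> to
  \<open>z\<close> and reading through \<open>y\<close> is the same as reading through
  \<open>relocate y (z, w)\<close>. Updates at sites that carry no label of \<open>A\<close> change
  nothing, so the infinite sum becomes finite.\<close>

lemma voter_pregenerator_comp:
  fixes G :: "('l \<Rightarrow> bool) set" and y :: "'l \<Rightarrow> int ^ 'd::finite"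
  assumes "finite A" and G: "determined_by A G"
  shows "voter_pregenerator R (\<lambda>\<xi>. indicator {\<xi>. \<xi> \<circ> y \<in> G} \<xi>) \<xi> =
    1 / card (B1 R - {0} :: (int ^ 'd) set) * (\<Sum>p\<in>y ` A \<times> (B1 R - {0}).
      indicator {\<xi>. \<xi> \<circ> relocate y p \<in> G} \<xi> - indicator {\<xi>. \<xi> \<circ> y \<in> G} \<xi>)"
proof -
  let ?J = "B1 R - {0} :: (int ^ 'd) set"
  let ?S = "{(x, y). 0 < l1_norm (x - y) \<and> l1_norm (x - y) \<le> int R} :: ((int ^ 'd) \<times> (int ^ 'd)) set"
  define f where "f = (\<lambda>\<xi>. indicator {\<xi>. \<xi> \<circ> y \<in> G} \<xi> :: real)"
  define g where "g p = (f (\<xi>(fst p := \<xi> (snd p))) - f \<xi>) / card ?J" for p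
  define \<phi> where "\<phi> p = (fst p, fst p + snd p)" for p :: "(int ^ 'd) \<times> (int ^ 'd)"
  have \<phi>: "inj_on \<phi> X" for X by (auto simp: inj_on_def \<phi>_def)
  have S: "p \<in> ?S \<longleftrightarrow> snd p - fst p \<in> ?J" for p
    using l1_norm_minus[of "fst p - snd p"] l1_norm_pos_iff[of "fst p - snd p"]
    by (cases p) (auto simp: B1_def)
  have zero: "f (\<xi>(z := b)) = f \<xi>" if "z \<notin> y ` A" for z b
  proof -
    have "\<xi>(z := b) \<circ> y \<in> G \<longleftrightarrow> \<xi> \<circ> y \<in> G"
      by (rule determined_byD[OF G]) (use that in auto)
    then show ?thesis by (simp add: f_def indicator_def)
  qed
  have "voter_pregenerator R f \<xi> = (\<Sum>\<^sub>\<infinity>p\<in>?S. g p)"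
    by (simp add: voter_pregenerator_def card_B1 g_def case_prod_beta')
  also have "\<dots> = (\<Sum>\<^sub>\<infinity>p\<in>\<phi> ` (y ` A \<times> ?J). g p)"
  proof (rule infsum_cong_neutral)
    fix p assume p: "p \<in> ?S - \<phi> ` (y ` A \<times> ?J)"
    have "p = \<phi> (fst p, snd p - fst p)" by (simp add: \<phi>_def)
    with p S[of p] have "fst p \<notin> y ` A" by blast
    then show "g p = 0" by (simp add: g_def zero)
  next
    fix p assume p: "p \<in> \<phi> ` (y ` A \<times> ?J) - ?S"
    then show "g p = 0" using S[of p] by (auto simp: \<phi>_def)
  qed simp
  also have "\<dots> = (\<Sum>p\<in>y ` A \<times> ?J. g (\<phi> p))"
    using assms(1) finite_B1 by (subst infsum_finite) (auto simp: sum.reindex[OF \<phi>])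
  also have "\<dots> = (\<Sum>p\<in>y ` A \<times> ?J. (indicator {\<xi>. \<xi> \<circ> relocate y p \<in> G} \<xi> - f \<xi>) / card ?J)"
  proof (rule sum.cong)
    fix p
    have "\<xi>(fst p := \<xi> (fst p + snd p)) \<circ> y = \<xi> \<circ> relocate y p"
      by (auto simp: relocate_def fun_eq_iff)
    then show "g (\<phi> p) = (indicator {\<xi>. \<xi> \<circ> relocate y p \<in> G} \<xi> - f \<xi>) / card ?J"
      by (simp add: g_def \<phi>_def f_def indicator_def)
  qed simp
  finally show ?thesis
    by (simp add: f_def sum_divide_distrib[symmetric])
qed

lemma prob_space_voter_law:
  assumes P: "voter_transition_function R P" and \<nu>: "prob_space \<nu>" "sets \<nu> = sets config_space" and t: "0 \<le> t"
  shows "prob_space (\<nu> \<bind> P t)" "sets (\<nu> \<bind> P t) = sets config_space"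
proof -
  have P_meas: "P t \<in> config_space \<rightarrow>\<^sub>M prob_algebra config_space"
    using P t unfolding voter_transition_function_def by blast
  then have "P t \<in> \<nu> \<rightarrow>\<^sub>M prob_algebra config_space"
    unfolding measurable_cong_sets[OF \<nu>(2) refl] .
  then have "sets (P t \<xi>) = sets config_space" for \<xi>
    using measurable_space[OF P_meas, of \<xi>] by (simp add: space_prob_algebra)
  then show "sets (\<nu> \<bind> P t) = sets config_space"
    using sets_bind[of \<nu> "P t"] prob_space.not_empty[OF \<nu>(1)] by simp
  show "prob_space (\<nu> \<bind> P t)"
    by (rule prob_space_bind'[OF _ P_meas]) (use \<nu> in \<open>simp add: space_prob_algebra\<close>)
qed

text \<open>The generator limit at time 0 is uniform in the starting configuration. After
  conditioning on the state at time \<open>t\<close>, by the semigroup property, one \<delta>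
  therefore serves all \<open>t\<close>; it may depend on \<open>y\<close>, which the comparison
  permits.\<close>

lemma voter_expansion:
  fixes G :: "('l \<Rightarrow> bool) set" and y :: "'l \<Rightarrow> int ^ 'd::finite"
    and \<nu> :: "'d config measure"
  assumes P: "voter_transition_function R P"
    and \<nu>: "prob_space \<nu>" "sets \<nu> = sets config_space"
    and A: "finite A" and G: "determined_by A G" and e: "0 < e"
  defines "U \<equiv> \<lambda>t y. measure (\<nu> \<bind> P t) {\<xi>. \<xi> \<circ> y \<in> G}"
  shows "\<exists>\<delta>>0. \<forall>t\<ge>0. \<forall>s>0. s < \<delta> \<longrightarrow> U (t + s) y \<le> U t y +
    s * (1 / card (B1 R - {0} :: (int ^ 'd) set) *
      (\<Sum>p\<in>y ` A \<times> (B1 R - {0}). U t (relocate y p) - U t y)) + s * e"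
proof -
  let ?r = "1 / card (B1 R - {0} :: (int ^ 'd) set)" and ?J = "B1 R - {0} :: (int ^ 'd) set"
  define X where "X y = {\<xi>. \<xi> \<circ> y \<in> G}" for y :: "'l \<Rightarrow> int ^ 'd"
  define f where "f = (\<lambda>\<xi>. indicator (X y) \<xi> :: real)"
  have det: "determined_by (y ` A) (X y)" for y
    unfolding X_def by (rule determined_by_vimage[OF G])
  have X [measurable]: "X y \<in> sets config_space" for y
    by (rule determined_by_measurable[OF _ det]) (use A in simp)
  have P_meas: "P t \<in> config_space \<rightarrow>\<^sub>M prob_algebra config_space" if "0 \<le> t" for t
    using P that unfolding voter_transition_function_def by blast
  have P_sub: "P t \<in> config_space \<rightarrow>\<^sub>M subprob_algebra config_space" if "0 \<le> t" for t
    using P_meas[OF that] by (rule measurable_prob_algebraD)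
  have P_prob: "prob_space (P t \<xi>)" "sets (P t \<xi>) = sets config_space" if "0 \<le> t" for t \<xi>
    using measurable_space[OF P_meas[OF that], of \<xi>] by (simp_all add: space_prob_algebra)
  have P_meas\<nu>: "P t \<in> \<nu> \<rightarrow>\<^sub>M subprob_algebra config_space" if "0 \<le> t" for t
    using P_sub[OF that] unfolding measurable_cong_sets[OF \<nu>(2) refl] .
  have "finitely_dependent f"
    unfolding finitely_dependent_def
  proof (intro exI conjI allI impI)
    fix \<xi> \<eta> :: "'d config" assume "\<forall>z\<in>y ` A. \<xi> z = \<eta> z"
    then have "\<xi> \<in> X y \<longleftrightarrow> \<eta> \<in> X y" by (intro determined_byD[OF det]) blast
    then show "f \<xi> = f \<eta>" by (simp add: f_def indicator_def)
  qed (use A in simp)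
  then have "uniform_limit UNIV (\<lambda>t \<xi>. ((\<integral>\<eta>. f \<eta> \<partial>P t \<xi>) - f \<xi>) / t) (voter_pregenerator R f) (at_right 0)"
    using P unfolding voter_transition_function_def by blast
  then have "\<forall>\<^sub>F s in at_right 0. \<forall>\<xi>. dist (((\<integral>\<eta>. f \<eta> \<partial>P s \<xi>) - f \<xi>) / s) (voter_pregenerator R f \<xi>) < e"
    using e by (simp add: uniform_limit_iff)
  then obtain \<delta> where \<delta>: "0 < \<delta>" and close: "\<And>s \<xi>. 0 < s \<Longrightarrow> s < \<delta> \<Longrightarrow>
      dist (((\<integral>\<eta>. f \<eta> \<partial>P s \<xi>) - f \<xi>) / s) (voter_pregenerator R f \<xi>) < e"
    unfolding eventually_at_right_field by blast
  have "U (t + s) y \<le> U t y + s * (?r * (\<Sum>p\<in>y ` A \<times> ?J. U t (relocate y p) - U t y)) + s * e"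
    if t: "0 \<le> t" and s: "0 < s" "s < \<delta>" for t s
  proof -
    define \<nu>t where "\<nu>t = \<nu> \<bind> P t"
    have \<nu>t_prob: "prob_space \<nu>t" and \<nu>t_sets [measurable_cong]: "sets \<nu>t = sets config_space"
      unfolding \<nu>t_def by (rule prob_space_voter_law[OF P \<nu> t])+
    interpret N: prob_space \<nu>t by (rule \<nu>t_prob)
    have space_\<nu>t: "space \<nu>t = UNIV" using sets_eq_imp_space_eq[OF \<nu>t_sets] by simp
    have U: "U t y = measure \<nu>t (X y)" for y by (simp add: U_def \<nu>t_def X_def)
    have "P (t + s) = (\<lambda>\<xi>. P t \<xi> \<bind> P s)"
      using P t s unfolding voter_transition_function_def by auto
    then have "\<nu> \<bind> P (t + s) = \<nu>t \<bind> P s"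
      using bind_assoc[OF P_meas\<nu>[OF t] P_sub[of s]] s by (simp add: \<nu>t_def)
    then have "U (t + s) y = (\<integral>\<xi>. measure (P s \<xi>) (X y) \<partial>\<nu>t)"
      using N.measure_bind[of "P s" config_space "X y"] P_sub[of s] s X
      by (simp add: U_def X_def cong: measurable_cong_sets)
    also have "\<dots> \<le> (\<integral>\<xi>. indicator (X y) \<xi> + s * (?r * (\<Sum>p\<in>y ` A \<times> ?J.
        indicator (X (relocate y p)) \<xi> - indicator (X y) \<xi>)) + s * e \<partial>\<nu>t)"
    proof (rule integral_mono)
      have "(\<lambda>\<xi>. measure (P s \<xi>) (X y)) \<in> borel_measurable \<nu>t"
        using measurable_compose[OF P_sub[of s] measurable_measure_subprob_algebra[OF X]] s
        by (simp cong: measurable_cong_sets)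
      then show "integrable \<nu>t (\<lambda>\<xi>. measure (P s \<xi>) (X y))"
        using s P_prob(1)[of s] by (intro N.integrable_const_bound[of _ 1]) (auto intro: prob_space.prob_le_1)
      show "integrable \<nu>t (\<lambda>\<xi>. indicator (X y) \<xi> + s * (?r * (\<Sum>p\<in>y ` A \<times> ?J.
          indicator (X (relocate y p)) \<xi> - indicator (X y) \<xi>)) + s * e :: real)"
        by (intro Bochner_Integration.integrable_add integrable_mult_right Bochner_Integration.integrable_sum
            Bochner_Integration.integrable_diff integrable_real_indicator N.integrable_const)
           (simp_all add: \<nu>t_sets N.emeasure_eq_measure)
      fix \<xi>
      have "space (P s \<xi>) = UNIV" using sets_eq_imp_space_eq[OF P_prob(2)[of s \<xi>]] s by simp
      then have "(\<integral>\<eta>. f \<eta> \<partial>P s \<xi>) = measure (P s \<xi>) (X y)" by (simp add: f_def)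
      moreover have "voter_pregenerator R f \<xi> = ?r * (\<Sum>p\<in>y ` A \<times> ?J.
          indicator (X (relocate y p)) \<xi> - indicator (X y) \<xi>)"
        unfolding f_def X_def by (rule voter_pregenerator_comp[OF A G])
      moreover have "(\<integral>\<eta>. f \<eta> \<partial>P s \<xi>) - f \<xi> \<le> (voter_pregenerator R f \<xi> + e) * s"
        using close[OF s, of \<xi>] s(1) by (simp add: dist_real_def abs_less_iff pos_divide_le_eq[symmetric])
      ultimately show "measure (P s \<xi>) (X y) \<le> indicator (X y) \<xi> + s * (?r * (\<Sum>p\<in>y ` A \<times> ?J.
          indicator (X (relocate y p)) \<xi> - indicator (X y) \<xi>)) + s * e"
        by (simp add: f_def algebra_simps)
    qed
    also have "\<dots> = U t y + s * (?r * (\<Sum>p\<in>y ` A \<times> ?J. U t (relocate y p) - U t y)) + s * e"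
      using A finite_B1 by (simp add: U space_\<nu>t \<nu>t_sets N.emeasure_eq_measure N.prob_space[unfolded space_\<nu>t])
    finally show ?thesis .
  qed
  with \<delta> show ?thesis by blast
qed

section \<open>Annihilating positions\<close>

definition annihilate :: "'a::ab_group_add set \<Rightarrow> 'a \<Rightarrow> 'a \<Rightarrow> 'a set" where
  "annihilate S z w = (if z + w \<in> S then S - {z, z + w} else insert (z + w) (S - {z}))"

text \<open>Every weight enters a matching at most once per vertex, so off collisions the matching sum is
  superharmonic in each position separately; a collision of \<open>z\<close> and \<open>v\<close> costs the factor
  \<open>1 / q\<^sup>2 = 1 + k v v\<close>, which is paid by the matchings containing that edge.\<close>

lemma matching_sum_superharmonic:
  fixes h :: "'a::ab_group_add \<Rightarrow> 'a \<Rightarrow> real"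
  assumes sym: "\<And>u v. h u v = h v u" and nonneg: "\<And>u v. 0 \<le> h u v" and refl: "\<And>u. h u u = 1"
    and super: "\<And>u v. (\<Sum>w\<in>J. h (u + w) v) \<le> card J * h u v"
    and q: "0 < q" "q \<le> 1" and J: "finite J" "0 \<notin> J" and S: "finite S" "z \<in> S"
  defines "k \<equiv> \<lambda>u v. (1 / q\<^sup>2 - 1) * h u v"
  shows "(\<Sum>w\<in>J. q ^ card (annihilate S z w) * matching_sum k (annihilate S z w))
    \<le> card J * (q ^ card S * matching_sum k S)"
proof -
  have "q\<^sup>2 \<le> 1" using q by (simp add: power_le_one)
  then have c: "0 \<le> 1 / q\<^sup>2 - 1" using q by simp
  have k: "\<And>u v. k u v = k v u" "\<And>u v. 0 \<le> k u v"
    using sym nonneg c by (auto simp: k_def)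
  define S' where "S' = S - {z}"
  have S': "finite S'" "z \<notin> S'" "S = insert z S'" "card S = Suc (card S')"
    using S card.remove[OF S] by (auto simp: S'_def)
  \<comment> \<open>For \<open>u\<close> outside \<open>S'\<close> this is the matching sum of
    \<open>insert u S'\<close>. The same formula makes sense at \<open>u\<close> in
    \<open>S'\<close>, where it dominates the value after a collision, so both cases can be averaged
    together.\<close>
  let ?g = "\<lambda>u. matching_sum k S' + (\<Sum>v\<in>S'. k u v * matching_sum k (S' - {v}))"
  have ms: "0 \<le> matching_sum k T" if "finite T" for T
    using matching_sum_ge_1[of k, OF k that] by simp
  have "q ^ card (annihilate S z w) * matching_sum k (annihilate S z w) \<le> q ^ card S * ?g (z + w)"
    if w: "w \<in> J" for w
  proof (cases "z + w \<in> S")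
    case False
    then have "annihilate S z w = insert (z + w) S'" "z + w \<notin> S'"
      by (auto simp: annihilate_def S'_def)
    then show ?thesis using S' matching_sum_insert[of k, OF k(1) S'(1)] by simp
  next
    case True
    moreover have "z + w \<noteq> z" using w J by auto
    ultimately have zw: "z + w \<in> S'" by (simp add: S'_def)
    have ann: "annihilate S z w = S' - {z + w}" using True by (auto simp: annihilate_def S'_def)
    have card: "card S = Suc (Suc (card (S' - {z + w})))"
      using S'(4) card.remove[OF S'(1) zw] by simp
    have "(1 + k (z + w) (z + w)) * matching_sum k (S' - {z + w}) \<le> ?g (z + w)"
    proof -
      have "matching_sum k (S' - {z + w}) \<le> matching_sum k S'"
        by (rule matching_sum_mono[of k, OF k S'(1)]) auto
      moreover have "k (z + w) (z + w) * matching_sum k (S' - {z + w})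
          \<le> (\<Sum>v\<in>S'. k (z + w) v * matching_sum k (S' - {v}))"
        using zw S' k ms by (intro member_le_sum[where f = "\<lambda>v. k (z + w) v * matching_sum k (S' - {v})"]) auto
      ultimately show ?thesis by (simp add: algebra_simps)
    qed
    then have "q ^ card S * ((1 + k (z + w) (z + w)) * matching_sum k (S' - {z + w})) \<le> q ^ card S * ?g (z + w)"
      using q by (intro mult_left_mono) auto
    moreover have "q ^ card S * (1 + k (z + w) (z + w)) = q ^ card (S' - {z + w})"
      using q unfolding card by (simp add: k_def refl power2_eq_square)
    ultimately show ?thesis by (simp add: ann mult.assoc[symmetric])
  qed
  then have "(\<Sum>w\<in>J. q ^ card (annihilate S z w) * matching_sum k (annihilate S z w))
      \<le> (\<Sum>w\<in>J. q ^ card S * ?g (z + w))" by (rule sum_mono)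
  also have "\<dots> = q ^ card S * (card J * matching_sum k S' +
      (\<Sum>v\<in>S'. (\<Sum>w\<in>J. k (z + w) v) * matching_sum k (S' - {v})))"
    by (simp add: sum_distrib_left[symmetric] sum.distrib sum_distrib_right sum.swap[of _ S' J])
  also have "\<dots> \<le> q ^ card S * (card J * matching_sum k S' +
      (\<Sum>v\<in>S'. (card J * k z v) * matching_sum k (S' - {v})))"
  proof -
    have "(\<Sum>w\<in>J. k (z + w) v) \<le> card J * k z v" for v
      using mult_left_mono[OF super[of z v] c] by (simp add: k_def sum_distrib_left[symmetric] mult.left_commute)
    then show ?thesis
      using q S' by (intro mult_left_mono add_left_mono sum_mono mult_right_mono ms) auto
  qed
  also have "\<dots> = card J * (q ^ card S * matching_sum k S)"
    using matching_sum_insert[of k, OF k(1) S'(1,2)] S'(3)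
    by (simp add: algebra_simps sum_distrib_left)
  finally show ?thesis .
qed

text \<open>Parity extracts annihilating walks from coalescing labels: two odd groups merge into an
  even one, which no longer counts as a particle.\<close>

definition odd_positions :: "'l set \<Rightarrow> ('l \<Rightarrow> 'a) \<Rightarrow> 'a set" where
  "odd_positions A y = {z. odd (card {a \<in> A. y a = z})}"

lemma odd_positions_subset: "odd_positions A y \<subseteq> y ` A"
proof
  fix z assume z: "z \<in> odd_positions A y"
  have "{a \<in> A. y a = z} \<noteq> {}"
  proof
    assume "{a \<in> A. y a = z} = {}"
    with z show False by (simp add: odd_positions_def)
  qed
  then show "z \<in> y ` A" by auto
qed

text \<open>Moving a group empties \<open>z\<close> and adds its size to the count at
  \<open>z + w\<close>. An even group thus changes no parity, and an odd one flips the parity at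
  \<open>z + w\<close>.\<close>

lemma odd_positions_relocate:
  fixes y :: "'l \<Rightarrow> 'a::ab_group_add"
  assumes "finite A" "w \<noteq> 0"
  shows "odd_positions A (relocate y (z, w)) =
    (if z \<in> odd_positions A y then annihilate (odd_positions A y) z w else odd_positions A y)"
proof -
  let ?y = "relocate y (z, w)"
  have [simp]: "z + w \<noteq> z" using assms(2) by simp
  have "{a \<in> A. ?y a = z} = {}" using assms(2) by (auto simp: relocate_def)
  then have 1: "card {a \<in> A. ?y a = z} = 0" by (simp only: card.empty)
  have "{a \<in> A. ?y a = z + w} = {a \<in> A. y a = z} \<union> {a \<in> A. y a = z + w}"
    by (auto simp: relocate_def)
  then have 2: "card {a \<in> A. ?y a = z + w} = card {a \<in> A. y a = z} + card {a \<in> A. y a = z + w}"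
    using assms by (simp add: card_Un_disjoint disjoint_iff)
  have 3: "{a \<in> A. ?y a = b} = {a \<in> A. y a = b}" if "b \<noteq> z" "b \<noteq> z + w" for b
    using that by (auto simp: relocate_def)
  have mem: "b \<in> odd_positions A ?y \<longleftrightarrow> (if b = z then False else if b = z + w then
      (z \<in> odd_positions A y) \<noteq> (z + w \<in> odd_positions A y) else b \<in> odd_positions A y)" for b
    using 1 2 3[of b] unfolding odd_positions_def mem_Collect_eq by (auto simp del: card_eq_0_iff)
  show ?thesis
    by (rule set_eqI) (auto simp: mem annihilate_def)
qed

lemma odd_positions_id: "odd_positions A (\<lambda>a. a) = A"
proof (rule set_eqI)
  fix z
  have "{a \<in> A. a = z} = (if z \<in> A then {z} else {})" by auto
  then show "z \<in> odd_positions A (\<lambda>a. a) \<longleftrightarrow> z \<in> A" by (simp add: odd_positions_def)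
qed

section \<open>Product measures of coalesced events\<close>

lemma prob_space_bernoulli_product: "prob_space (bernoulli_product \<alpha>)"
  unfolding bernoulli_product_def by (intro prob_space_PiM measure_pmf.prob_space_axioms)

lemma sets_bernoulli_product: "sets (bernoulli_product \<alpha>) = sets config_space"
  unfolding bernoulli_product_def config_space_def by (rule sets_PiM_cong) auto

lemma space_bernoulli_product: "space (bernoulli_product \<alpha>) = UNIV"
  using sets_eq_imp_space_eq[OF sets_bernoulli_product] by simp

lemma indep_vars_bernoulli_product:
  "prob_space.indep_vars (bernoulli_product \<alpha> :: 'd::finite config measure)
     (\<lambda>_. measure_pmf (bernoulli_pmf \<alpha>)) (\<lambda>a \<xi>. \<xi> a) UNIV"
proof -
  interpret prob_space "bernoulli_product \<alpha> :: 'd config measure"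
    by (rule prob_space_bernoulli_product)
  have "distr (bernoulli_product \<alpha>) (measure_pmf (bernoulli_pmf \<alpha>)) (\<lambda>\<xi>. \<xi> a) = measure_pmf (bernoulli_pmf \<alpha>)"
    for a :: "int ^ 'd"
    unfolding bernoulli_product_def
    by (rule distr_PiM_component) (auto intro: measure_pmf.prob_space_axioms)
  then show ?thesis
    by (subst indep_vars_iff_distr_eq_PiM') (simp_all add: bernoulli_product_def distr_id2 restrict_UNIV)
qed

lemma determined_by_cylinder_event:
  assumes "E \<in> cylinder_events B"
  shows "determined_by B E"
proof -
  obtain E0 where E: "E = {\<xi>. restrict \<xi> B \<in> E0}" using assms by (auto simp: cylinder_events_def)
  show ?thesis
    unfolding determined_by_def E mem_Collect_eq
  proof (intro allI impI)
    fix \<xi> \<eta> :: "int ^ 'a \<Rightarrow> bool" assume "\<forall>a\<in>B. \<xi> a = \<eta> a"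
    then have "restrict \<xi> B = restrict \<eta> B" by (auto simp: restrict_def)
    then show "restrict \<xi> B \<in> E0 \<longleftrightarrow> restrict \<eta> B \<in> E0" by simp
  qed
qed

lemma sets_PiM_bernoulli_finite:
  assumes "finite K" "X \<subseteq> K \<rightarrow>\<^sub>E UNIV"
  shows "X \<in> sets (Pi\<^sub>M K (\<lambda>_. measure_pmf (bernoulli_pmf \<alpha>)))"
proof -
  have "sets (Pi\<^sub>M K (\<lambda>_. measure_pmf (bernoulli_pmf \<alpha>))) = sets (Pi\<^sub>M K (\<lambda>_. count_space UNIV))"
    by (rule sets_PiM_cong) auto
  also have "\<dots> = Pow (K \<rightarrow>\<^sub>E UNIV)"
    using assms(1) by (simp add: count_space_PiM_finite)
  finally show ?thesis using assms(2) by simp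
qed

text \<open>Coordinates read through an injective map have the same product law over
  \<open>B\<close> as the original ones, so both sides are the probability of one set
  \<open>E0\<close> in that finite product.\<close>

lemma bernoulli_product_reindex:
  fixes E :: "'d::finite config set" and \<phi> :: "int ^ 'd \<Rightarrow> int ^ 'd"
  assumes B: "finite B" and E: "determined_by B E" and \<phi>: "inj_on \<phi> B"
  shows "measure (bernoulli_product \<alpha>) {\<xi>. \<xi> \<circ> \<phi> \<in> E} = measure (bernoulli_product \<alpha>) E"
proof -
  let ?M = "\<lambda>_ :: int ^ 'd. measure_pmf (bernoulli_pmf \<alpha>)"
  define E0 where "E0 = {g \<in> B \<rightarrow>\<^sub>E UNIV. g \<in> E}"
  have E0: "E0 \<in> sets (Pi\<^sub>M B ?M)"
    unfolding E0_def by (rule sets_PiM_bernoulli_finite[OF B]) auto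
  have *: "measure (bernoulli_product \<alpha>) {\<xi>. \<xi> \<circ> \<psi> \<in> E} = measure (Pi\<^sub>M B ?M) E0"
    if \<psi>: "inj_on \<psi> B" for \<psi> :: "int ^ 'd \<Rightarrow> int ^ 'd"
  proof -
    have "distr (bernoulli_product \<alpha>) (Pi\<^sub>M B ?M) (\<lambda>\<xi>. \<lambda>b\<in>B. \<xi> (\<psi> b)) = Pi\<^sub>M B ?M"
      unfolding bernoulli_product_def
      by (rule distr_PiM_reindex) (use \<psi> in \<open>auto intro: measure_pmf.prob_space_axioms\<close>)
    then have "measure (Pi\<^sub>M B ?M) E0 =
        measure (distr (bernoulli_product \<alpha>) (Pi\<^sub>M B ?M) (\<lambda>\<xi>. \<lambda>b\<in>B. \<xi> (\<psi> b))) E0" by simp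
    also have "\<dots> = measure (bernoulli_product \<alpha>) ((\<lambda>\<xi>. \<lambda>b\<in>B. \<xi> (\<psi> b)) -` E0 \<inter> space (bernoulli_product \<alpha>))"
      by (rule measure_distr[OF _ E0]) (unfold bernoulli_product_def, measurable)
    also have "(\<lambda>\<xi>. \<lambda>b\<in>B. \<xi> (\<psi> b)) -` E0 \<inter> space (bernoulli_product \<alpha>) = {\<xi>. \<xi> \<circ> \<psi> \<in> E}"
    proof -
      have "(\<lambda>b\<in>B. \<xi> (\<psi> b)) \<in> E \<longleftrightarrow> \<xi> \<circ> \<psi> \<in> E" for \<xi>
        by (rule determined_byD[OF E]) simp
      then show ?thesis by (auto simp: E0_def space_bernoulli_product)
    qed
    finally show ?thesis by simp
  qed
  from *[OF \<phi>] *[of id] show ?thesis by simp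
qed

text \<open>Joint injectivity makes the blocks read disjoint sets of coordinates, hence independent
  ones.\<close>

lemma bernoulli_product_blocks:
  fixes E :: "'d::finite config set" and \<phi> :: "nat \<Rightarrow> int ^ 'd \<Rightarrow> int ^ 'd"
  assumes B: "finite B" and E: "determined_by B E" and I: "finite I"
    and inj: "inj_on (\<lambda>(i, b). \<phi> i b) (I \<times> B)"
  shows "measure (bernoulli_product \<alpha>) {\<xi>. \<forall>i\<in>I. \<xi> \<circ> \<phi> i \<in> E} = measure (bernoulli_product \<alpha>) E ^ card I"
proof (cases "I = {}")
  case True
  then show ?thesis
    using prob_space.prob_space[OF prob_space_bernoulli_product, unfolded space_bernoulli_product] by simp
next
  case False
  interpret prob_space "bernoulli_product \<alpha> :: 'd config measure"
    by (rule prob_space_bernoulli_product)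
  let ?M = "\<lambda>_ :: int ^ 'd. measure_pmf (bernoulli_pmf \<alpha>)"
  define K where "K i = \<phi> i ` B" for i
  define X where "X i = {g \<in> K i \<rightarrow>\<^sub>E UNIV. g \<circ> \<phi> i \<in> E}" for i
  have "disjoint_family_on K I"
    using inj by (auto simp: disjoint_family_on_def K_def inj_on_def)
  then have indep: "indep_vars (\<lambda>i. Pi\<^sub>M (K i) ?M) (\<lambda>i \<xi>. restrict (\<lambda>a. \<xi> a) (K i)) I"
    by (intro indep_vars_restrict[OF indep_vars_bernoulli_product]) auto
  have pre: "(\<lambda>\<xi>. restrict (\<lambda>a. \<xi> a) (K i)) -` X i \<inter> space (bernoulli_product \<alpha>) = {\<xi>. \<xi> \<circ> \<phi> i \<in> E}" for i
  proof -
    have "restrict \<xi> (K i) \<circ> \<phi> i \<in> E \<longleftrightarrow> \<xi> \<circ> \<phi> i \<in> E" for \<xi>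
      by (rule determined_byD[OF E]) (simp add: K_def)
    then show ?thesis by (auto simp: X_def space_bernoulli_product)
  qed
  have "prob (\<Inter>i\<in>I. (\<lambda>\<xi>. restrict (\<lambda>a. \<xi> a) (K i)) -` X i \<inter> space (bernoulli_product \<alpha>)) =
      (\<Prod>i\<in>I. prob ((\<lambda>\<xi>. restrict (\<lambda>a. \<xi> a) (K i)) -` X i \<inter> space (bernoulli_product \<alpha>)))"
    using B by (intro indep_varsD_finite[OF indep False I] sets_PiM_bernoulli_finite) (auto simp: K_def X_def)
  also have "\<dots> = (\<Prod>i\<in>I. prob E)"
  proof (rule prod.cong)
    fix i assume "i \<in> I"
    then have "inj_on (\<phi> i) B" using inj by (auto simp: inj_on_def)
    then show "prob ((\<lambda>\<xi>. restrict (\<lambda>a. \<xi> a) (K i)) -` X i \<inter> space (bernoulli_product \<alpha>)) = prob E"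
      unfolding pre by (rule bernoulli_product_reindex[OF B E])
  qed simp
  also have "(\<Inter>i\<in>I. (\<lambda>\<xi>. restrict (\<lambda>a. \<xi> a) (K i)) -` X i \<inter> space (bernoulli_product \<alpha>)) =
      {\<xi>. \<forall>i\<in>I. \<xi> \<circ> \<phi> i \<in> E}"
    unfolding pre by auto
  finally show ?thesis by simp
qed

lemma shift_event_iff: "\<eta> \<in> shift_event x E \<longleftrightarrow> (\<lambda>b. \<eta> (x + b)) \<in> E"
proof
  assume "\<eta> \<in> shift_event x E"
  then show "(\<lambda>b. \<eta> (x + b)) \<in> E" by (auto simp: shift_event_def shift_config_def)
next
  assume "(\<lambda>b. \<eta> (x + b)) \<in> E"
  then show "\<eta> \<in> shift_event x E"
    unfolding shift_event_def
    by (rule image_eqI[rotated]) (simp add: shift_config_def)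
qed

lemma determined_by_shift_events:
  assumes "determined_by B E"
  shows "determined_by (\<Union>i\<in>I. (\<lambda>b. x i + b) ` B) (\<Inter>i\<in>I. shift_event (x i) E)"
  unfolding determined_by_def
proof (intro allI impI)
  fix \<xi> \<eta> :: "int ^ 'a \<Rightarrow> bool" assume eq: "\<forall>a\<in>(\<Union>i\<in>I. (\<lambda>b. x i + b) ` B). \<xi> a = \<eta> a"
  have "(\<lambda>b. \<xi> (x i + b)) \<in> E \<longleftrightarrow> (\<lambda>b. \<eta> (x i + b)) \<in> E" if "i \<in> I" for i
    by (rule determined_byD[OF assms]) (use eq that in auto)
  then show "\<xi> \<in> (\<Inter>i\<in>I. shift_event (x i) E) \<longleftrightarrow> \<eta> \<in> (\<Inter>i\<in>I. shift_event (x i) E)"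
    by (simp add: shift_event_iff)
qed

text \<open>Keep the blocks all of whose labels are the chosen representatives of their positions. Each
  discarded block contains a label that is not a representative, and there are
  \<open>card A - card (y ` A)\<close> of these.\<close>

lemma bernoulli_product_coalesced_le:
  fixes E :: "'d::finite config set" and x :: "nat \<Rightarrow> int ^ 'd" and y :: "int ^ 'd \<Rightarrow> int ^ 'd"
    and \<alpha> :: real
  assumes B: "finite B" and E: "determined_by B E" and I: "finite I"
    and disj: "disjoint_family_on (\<lambda>i. (\<lambda>b. x i + b) ` B) I"
  defines "A \<equiv> \<Union>i\<in>I. (\<lambda>b. x i + b) ` B" and "p \<equiv> measure (bernoulli_product \<alpha>) E"
  shows "p ^ card A * measure (bernoulli_product \<alpha>) {\<xi>. \<xi> \<circ> y \<in> (\<Inter>i\<in>I. shift_event (x i) E)}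
    \<le> p ^ card I * p ^ card (y ` A)"
proof -
  interpret prob_space "bernoulli_product \<alpha> :: 'd config measure"
    by (rule prob_space_bernoulli_product)
  have finA: "finite A" using B I by (simp add: A_def)
  obtain T where T: "T \<subseteq> A" "inj_on y T" "y ` A = y ` T"
    using subset_image_inj[of "y ` A" y A] by auto
  define I' where "I' = {i \<in> I. (\<lambda>b. x i + b) ` B \<subseteq> T}"
  have finI': "finite I'" using I by (simp add: I'_def)
  have "\<exists>a. a \<in> (\<lambda>b. x i + b) ` B \<and> a \<notin> T" if "i \<in> I - I'" for i
    using that by (auto simp: I'_def)
  then obtain g where g: "\<And>i. i \<in> I - I' \<Longrightarrow> g i \<in> (\<lambda>b. x i + b) ` B \<and> g i \<notin> T" by metis
  have "inj_on g (I - I')"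
    using disj g unfolding inj_on_def disjoint_family_on_def by (metis Diff_iff disjoint_iff)
  moreover have "g ` (I - I') \<subseteq> A - T" using g by (auto simp: A_def)
  ultimately have "card (I - I') \<le> card (A - T)" using finA by (intro card_inj_on_le) auto
  moreover have "card (I - I') = card I - card I'" "card I' \<le> card I"
    using I by (auto simp: I'_def intro!: card_Diff_subset card_mono)
  moreover have "card (A - T) = card A - card T" "card T \<le> card A"
    using finA T by (auto intro!: card_Diff_subset card_mono intro: finite_subset)
  moreover have "card T = card (y ` A)" unfolding T(3) using T(2) by (simp add: card_image)
  \<comment> \<open>Stated with sums to avoid truncated subtraction; this is why the lemma carries
    the factor \<open>p ^ card A\<close> on the left.\<close>
  ultimately have exponents: "card I + card (y ` A) \<le> card A + card I'" by linarith
  \<comment> \<open>The kept labels are representatives, on which \<open>y\<close> is injective, and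
    the blocks are disjoint; so the kept blocks still read distinct sites after coalescence.\<close>
  have "inj_on (\<lambda>(i, b). y (x i + b)) (I' \<times> B)"
  proof (rule inj_onI, clarify)
    fix i b i' b' assume i: "i \<in> I'" "b \<in> B" "i' \<in> I'" "b' \<in> B" and eq: "y (x i + b) = y (x i' + b')"
    have eq: "x i + b = x i' + b'"
      by (rule inj_onD[OF T(2) eq]) (use i in \<open>auto simp: I'_def\<close>)
    have "i = i'"
    proof (rule ccontr)
      assume "i \<noteq> i'"
      then have "(\<lambda>b. x i + b) ` B \<inter> (\<lambda>b. x i' + b) ` B = {}"
        using disj i by (auto simp: disjoint_family_on_def I'_def)
      with eq i show False by blast
    qed
    with eq show "i = i' \<and> b = b'" by simp
  qed
  then have "prob {\<xi>. \<forall>i\<in>I'. \<xi> \<circ> (\<lambda>b. y (x i + b)) \<in> E} = p ^ card I'"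
    unfolding p_def by (rule bernoulli_product_blocks[OF B E finI'])
  moreover have "prob {\<xi>. \<xi> \<circ> y \<in> (\<Inter>i\<in>I. shift_event (x i) E)} \<le>
      prob {\<xi>. \<forall>i\<in>I'. \<xi> \<circ> (\<lambda>b. y (x i + b)) \<in> E}"
  proof (rule finite_measure_mono)
    have "determined_by (y ` (\<Union>i\<in>I'. (\<lambda>b. x i + b) ` B)) {\<xi>. \<forall>i\<in>I'. \<xi> \<circ> (\<lambda>b. y (x i + b)) \<in> E}"
      unfolding determined_by_def
    proof (intro allI impI)
      fix \<xi> \<eta> :: "'d config"
      assume eq: "\<forall>a\<in>y ` (\<Union>i\<in>I'. (\<lambda>b. x i + b) ` B). \<xi> a = \<eta> a"
      have "\<xi> \<circ> (\<lambda>b. y (x i + b)) \<in> E \<longleftrightarrow> \<eta> \<circ> (\<lambda>b. y (x i + b)) \<in> E" if "i \<in> I'" for i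
        by (rule determined_byD[OF E]) (use eq that in auto)
      then show "\<xi> \<in> {\<xi>. \<forall>i\<in>I'. \<xi> \<circ> (\<lambda>b. y (x i + b)) \<in> E} \<longleftrightarrow> \<eta> \<in> {\<xi>. \<forall>i\<in>I'. \<xi> \<circ> (\<lambda>b. y (x i + b)) \<in> E}"
        by blast
    qed
    then show "{\<xi>. \<forall>i\<in>I'. \<xi> \<circ> (\<lambda>b. y (x i + b)) \<in> E} \<in> events"
      unfolding sets_bernoulli_product using finI' B by (intro determined_by_measurable) auto
  qed (auto simp: shift_event_iff I'_def o_def)
  ultimately have "p ^ card A * prob {\<xi>. \<xi> \<circ> y \<in> (\<Inter>i\<in>I. shift_event (x i) E)} \<le> p ^ card A * p ^ card I'"
    by (intro mult_left_mono) (auto simp: p_def)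
  also have "\<dots> \<le> p ^ card I * p ^ card (y ` A)"
    unfolding power_add[symmetric] using exponents by (intro power_decreasing) (auto simp: p_def)
  finally show ?thesis .
qed

section \<open>The upper bound\<close>

text \<open>An event determined by finitely many coordinates is clopen in the product topology, so
  convergence in distribution applies to its indicator directly.\<close>

lemma continuous_on_indicator_determined:
  fixes G :: "('l \<Rightarrow> bool) set"
  assumes A: "finite A" and G: "determined_by A G"
  shows "continuous_on UNIV (indicator G :: ('l \<Rightarrow> bool) \<Rightarrow> real)"
proof -
  have op: "open H" if H: "determined_by A H" for H :: "('l \<Rightarrow> bool) set"
  proof -
    have "open ((\<lambda>\<eta> :: 'l \<Rightarrow> bool. \<eta> a) -` {b})" for a b
      by (rule open_vimage[OF discrete_topology_class.open_discrete continuous_on_product_coordinates])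
    then have "open (\<Union>\<xi>\<in>H. \<Inter>a\<in>A. (\<lambda>\<eta>. \<eta> a) -` {\<xi> a})"
      using A by (intro open_UN ballI open_INT) auto
    also have "(\<Union>\<xi>\<in>H. \<Inter>a\<in>A. (\<lambda>\<eta>. \<eta> a) -` {\<xi> a}) = H"
    proof (intro equalityI subsetI)
      fix \<eta> assume "\<eta> \<in> (\<Union>\<xi>\<in>H. \<Inter>a\<in>A. (\<lambda>\<eta>. \<eta> a) -` {\<xi> a})"
      then obtain \<xi> where "\<xi> \<in> H" "\<And>a. a \<in> A \<Longrightarrow> \<eta> a = \<xi> a" by auto
      then show "\<eta> \<in> H" using determined_byD[OF H, of \<eta> \<xi>] by simp
    qed auto
    finally show ?thesis .
  qed
  have "determined_by A (- G)" using G unfolding determined_by_def by simp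
  then have "closed G" "closed (- G)" using op G by (simp_all add: closed_def)
  then have "continuous_on (G \<union> - G) (\<lambda>\<xi>. if \<xi> \<in> G then 1 else 0 :: real)"
    by (intro continuous_on_cases) auto
  then show ?thesis by (simp add: indicator_def[abs_def] of_bool_def)
qed

lemma voter_law_blocks_le:
  fixes R :: nat and \<alpha> :: real and B :: "(int ^ 'd::finite) set" and x :: "nat \<Rightarrow> int ^ 'd" and E :: "'d config set"
  assumes R: "R > 0" and P: "voter_transition_function R P"
    and B: "finite B" and I: "finite I"
    and disj: "disjoint_family_on (\<lambda>i. (\<lambda>b. x i + b) ` B) I"
    and E: "determined_by B E" and pos: "measure (bernoulli_product \<alpha>) E > 0" and T: "0 \<le> T"
  defines "A \<equiv> \<Union>i\<in>I. (\<lambda>b. x i + b) ` B" and "p \<equiv> measure (bernoulli_product \<alpha>) E"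
  shows "measure (bernoulli_product \<alpha> \<bind> P T) (\<Inter>i\<in>I. shift_event (x i) E)
    \<le> p ^ card I * matching_sum (\<lambda>u v. (1 / p\<^sup>2 - 1) * regular_meeting_prob R u v) A"
proof -
  interpret \<pi>: prob_space "bernoulli_product \<alpha> :: 'd config measure"
    by (rule prob_space_bernoulli_product)
  let ?J = "B1 R - {0} :: (int ^ 'd) set"
  define G where "G = (\<Inter>i\<in>I. shift_event (x i) E)"
  define k where "k u v = (1 / p\<^sup>2 - 1) * regular_meeting_prob R u v" for u v :: "int ^ 'd"
  define \<psi> where "\<psi> S = p ^ card S * matching_sum k S" for S
  define c where "c = p ^ card I / p ^ card A"
  \<comment> \<open>If the positions hold \<open>m\<close> labels each,
    \<open>card A - card (odd_positions A y)\<close> is the sum of \<open>2 * (m div 2)\<close>. So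
    \<open>V y\<close> is \<open>p ^ card I\<close> times a factor \<open>1 / p\<^sup>2\<close> for
    every pair already annihilated, times the matching sum of what remains.\<close>
  define V where "V y = c * \<psi> (odd_positions A y)" for y
  define U where "U t y = measure (bernoulli_product \<alpha> \<bind> P t) {\<xi>. \<xi> \<circ> y \<in> G}" for t y
  have p: "0 < p" "p \<le> 1" using pos by (simp_all add: p_def)
  have c: "0 < c" using p by (simp add: c_def)
  have J: "finite ?J" "?J \<noteq> {}" "card ?J > 0"
    using finite_B1 B1_nontrivial[OF R] by (auto simp: card_gt_0_iff)
  have A: "finite A" using B I by (simp add: A_def)
  have "p\<^sup>2 \<le> 1" using p by (simp add: power_le_one)
  then have c': "0 \<le> 1 / p\<^sup>2 - 1" using p by simp
  have k: "k u v = k v u" "0 \<le> k u v" for u v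
    using regular_meeting_prob_commute[of R u v] mult_nonneg_nonneg[OF c' regular_meeting_prob_nonneg]
    by (simp_all add: k_def)
  have finO: "finite (odd_positions A y)" for y :: "int ^ 'd \<Rightarrow> int ^ 'd"
    by (rule finite_subset[OF odd_positions_subset]) (use A in simp)
  have \<psi>_ge: "p ^ card S \<le> \<psi> S" if "finite S" for S
    using mult_left_mono[OF matching_sum_ge_1[of k, OF k that], of "p ^ card S"] p by (simp add: \<psi>_def)
  have V0: "0 \<le> V y" for y
  proof -
    have "0 \<le> p ^ card (odd_positions A y)" using p by simp
    also note \<psi>_ge[OF finO]
    finally show ?thesis using c by (simp add: V_def)
  qed
  have G: "determined_by A G"
    unfolding A_def G_def by (rule determined_by_shift_events[OF E])
  have "U T (\<lambda>a. a) \<le> V (\<lambda>a. a)"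
  \<comment> \<open>At most \<open>card A\<close> sites are occupied and each jumps at rate 1,
    whence \<Lambda>; the constant 1 works because \<open>U\<close> is a probability and
    \<open>V\<close> is nonnegative.\<close>
  proof (rule jump_process_comparison[where U = U and V = V and I = "\<lambda>y. y ` A \<times> ?J" and m = relocate
        and r = "1 / card ?J" and \<Lambda> = "card A" and ?C0.0 = 1])
    show "finite (y ` A \<times> ?J)" for y :: "int ^ 'd \<Rightarrow> int ^ 'd" using A J by blast
    show "1 / real (card ?J) * real (card (y ` A \<times> ?J)) \<le> real (card A)" for y :: "int ^ 'd \<Rightarrow> int ^ 'd"
      using J card_image_le[OF A, of y] by (simp add: card_cartesian_product)
    show "U t y \<le> V y + 1" if "0 \<le> t" for t y
      using prob_space.prob_le_1[OF prob_space_voter_law(1)[OF P \<pi>.prob_space_axioms sets_bernoulli_product that]]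
        V0[of y] unfolding U_def by (smt (verit))
    show "U 0 y \<le> V y" for y
    proof -
      have "P 0 = return config_space"
        using P unfolding voter_transition_function_def by auto
      then have U0: "U 0 y = \<pi>.prob {\<xi>. \<xi> \<circ> y \<in> G}"
        by (simp add: U_def bind_return''[OF sets_bernoulli_product])
      \<comment> \<open>Each position with an odd count is occupied, and \<open>p\<close> is at most
        1; this is \<open>m - 1 \<le> 2 * (m div 2)\<close> summed over positions.\<close>
      have "p ^ card (y ` A) \<le> p ^ card (odd_positions A y)"
        using p A by (intro power_decreasing card_mono odd_positions_subset) auto
      also have "\<dots> \<le> \<psi> (odd_positions A y)" by (rule \<psi>_ge[OF finO])
      finally have le: "p ^ card (y ` A) \<le> \<psi> (odd_positions A y)" .
      have "p ^ card A * U 0 y \<le> p ^ card I * p ^ card (y ` A)"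
        using bernoulli_product_coalesced_le[OF B E I disj, of \<alpha> y]
        unfolding U0 G_def A_def p_def .
      also have "\<dots> \<le> p ^ card I * \<psi> (odd_positions A y)"
        using le p by (intro mult_left_mono) auto
      finally show ?thesis using p by (simp add: V_def c_def field_simps)
    qed
    show "(\<Sum>q\<in>y ` A \<times> ?J. V (relocate y q) - V y) \<le> 0" for y
    proof -
      have inner: "(\<Sum>w\<in>?J. \<psi> (odd_positions A (relocate y (z, w))) - \<psi> (odd_positions A y)) \<le> 0" for z
      proof (cases "z \<in> odd_positions A y")
        case True
        let ?S = "odd_positions A y"
        have "(\<Sum>w\<in>?J. \<psi> (odd_positions A (relocate y (z, w)))) = (\<Sum>w\<in>?J. \<psi> (annihilate ?S z w))"
          using True A by (intro sum.cong) (auto simp: odd_positions_relocate)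
        also have "\<dots> \<le> card ?J * \<psi> ?S"
          unfolding \<psi>_def k_def
          by (rule matching_sum_superharmonic)
             (use regular_meeting_prob_commute regular_meeting_prob_nonneg regular_meeting_prob_refl
               regular_meeting_prob_superharmonic[OF R] p J(1) finO True in auto)
        finally show ?thesis by (simp add: sum_subtractf)
      next
        case False
        then have "odd_positions A (relocate y (z, w)) = odd_positions A y" if "w \<in> ?J" for w
          using A that by (simp add: odd_positions_relocate)
        then show ?thesis by simp
      qed
      have "(\<Sum>q\<in>y ` A \<times> ?J. V (relocate y q) - V y) =
          c * (\<Sum>z\<in>y ` A. \<Sum>w\<in>?J. \<psi> (odd_positions A (relocate y (z, w))) - \<psi> (odd_positions A y))"
        by (simp add: V_def sum.cartesian_product' sum_distrib_left right_diff_distrib)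
      also have "\<dots> \<le> 0"
        using c by (intro mult_nonneg_nonpos sum_nonpos[OF inner]) simp
      finally show ?thesis .
    qed
    show "\<exists>\<delta>>0. \<forall>t\<ge>0. \<forall>s>0. s < \<delta> \<longrightarrow> U (t + s) y \<le> U t y +
        s * (1 / real (card ?J) * (\<Sum>i\<in>y ` A \<times> ?J. U t (relocate y i) - U t y)) + s * e" if "0 < e" for y e
      unfolding U_def
      by (rule voter_expansion[OF P \<pi>.prob_space_axioms sets_bernoulli_product A G that])
  qed (use T in auto)
  moreover have "V (\<lambda>a. a) = p ^ card I * matching_sum k A"
    using p by (simp add: V_def \<psi>_def c_def odd_positions_id)
  moreover have "U T (\<lambda>a. a) = measure (bernoulli_product \<alpha> \<bind> P T) G"
    by (simp add: U_def o_def)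
  ultimately show ?thesis by (simp add: G_def k_def[abs_def])
qed

theorem lemma2:
  fixes R n :: nat
    and \<alpha> :: real
    and \<mu> :: "'d::finite config measure"
    and prec :: "(int ^ 'd) rel"
    and B :: "(int ^ 'd) set"
    and x :: "nat \<Rightarrow> int ^ 'd"
    and E :: "'d config set"
  assumes "CARD('d) \<ge> 3"
    and "R > 0"
    and "0 \<le> \<alpha>" "\<alpha> \<le> 1"
    and "voter_limit_law R \<alpha> \<mu>"
    and "well_order_on UNIV prec"
    and "finite B" "0 \<in> B"
    and "disjoint_family_on (\<lambda>i. (\<lambda>b. x i + b) ` B) {1..n}"
    and "E \<in> cylinder_events B"
    and "measure (bernoulli_product \<alpha>) E > 0"
  shows "measure \<mu> (\<Inter>i\<in>{1..n}. shift_event (x i) E)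
    \<le> measure (bernoulli_product \<alpha>) E ^ n *
      (\<Prod>(u, v)\<in>{(u, v). u \<in> (\<Union>i\<in>{1..n}. (\<lambda>b. x i + b) ` B) \<and>
                         v \<in> (\<Union>i\<in>{1..n}. (\<lambda>b. x i + b) ` B) \<and>
                         u \<noteq> v \<and> (u, v) \<in> prec}.
         1 + meeting_prob R u v * (measure (bernoulli_product \<alpha>) E powi (-2) - 1))"
proof -
  define A where "A = (\<Union>i\<in>{1..n}. (\<lambda>b. x i + b) ` B)"
  define G where "G = (\<Inter>i\<in>{1..n}. shift_event (x i) E)"
  define p where "p = measure (bernoulli_product \<alpha>) E"
  define k where "k u v = (1 / p\<^sup>2 - 1) * regular_meeting_prob R u v" for u v :: "int ^ 'd"
  let ?Q = "{(u, v). u \<in> A \<and> v \<in> A \<and> u \<noteq> v \<and> (u, v) \<in> prec}"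
  have A: "finite A" using assms(7) by (simp add: A_def)
  have p: "0 < p" "p \<le> 1"
    using assms(11) prob_space.prob_le_1[OF prob_space_bernoulli_product] by (simp_all add: p_def)
  then have "p\<^sup>2 \<le> 1" by (simp add: power_le_one)
  then have c: "0 \<le> 1 / p\<^sup>2 - 1" using p by simp
  have k: "k u v = k v u" "0 \<le> k u v" for u v
    using regular_meeting_prob_commute[of R u v] mult_nonneg_nonneg[OF c regular_meeting_prob_nonneg]
    by (simp_all add: k_def)
  have E: "determined_by B E" by (rule determined_by_cylinder_event[OF assms(10)])
  have G: "determined_by A G"
    unfolding A_def G_def by (rule determined_by_shift_events[OF E])
  from assms(5) obtain P where P: "voter_transition_function R P"
    and lim: "converges_in_distribution (\<lambda>t. bernoulli_product \<alpha> \<bind> P t) \<mu>"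
    unfolding voter_limit_law_def by blast
  have \<mu>: "space \<mu> = UNIV"
    using lim sets_eq_imp_space_eq[of \<mu> config_space] unfolding converges_in_distribution_def by simp
  have "((\<lambda>t. \<integral>\<xi>. indicator G \<xi> \<partial>(bernoulli_product \<alpha> \<bind> P t)) \<longlongrightarrow> (\<integral>\<xi>. indicator G \<xi> \<partial>\<mu> :: real)) at_top"
    using lim continuous_on_indicator_determined[OF A G] unfolding converges_in_distribution_def by blast
  moreover have "eventually (\<lambda>t. (\<integral>\<xi>. indicator G \<xi> \<partial>(bernoulli_product \<alpha> \<bind> P t)) \<le> p ^ n * matching_sum k A) at_top"
    using eventually_ge_at_top[of 0]
  proof eventually_elim
    case (elim t)
    have "space (bernoulli_product \<alpha> \<bind> P t) = (UNIV :: 'd config set)"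
      using sets_eq_imp_space_eq[OF prob_space_voter_law(2)[OF P prob_space_bernoulli_product sets_bernoulli_product elim]]
      by simp
    then show ?case
      using voter_law_blocks_le[OF assms(2) P assms(7) _ assms(9) E assms(11) elim]
      by (simp add: G_def A_def p_def k_def[abs_def])
  qed
  ultimately have "(\<integral>\<xi>. indicator G \<xi> \<partial>\<mu>) \<le> p ^ n * matching_sum k A"
    by (rule tendsto_upperbound) simp
  then have "measure \<mu> G \<le> p ^ n * matching_sum k A" by (simp add: \<mu>)
  also have "\<dots> \<le> p ^ n * (\<Prod>(u, v)\<in>?Q. 1 + k u v)"
  proof (rule mult_left_mono[OF matching_sum_le_prod[of k, OF k A]])
    have "total prec" "antisym prec"
      using assms(6) by (auto simp: well_order_on_def linear_order_on_def partial_order_on_def)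
    then show "total_on A prec" "antisym prec" by (auto simp: total_on_def)
  qed (use p in simp)
  also have "\<dots> \<le> p ^ n * (\<Prod>(u, v)\<in>?Q. 1 + meeting_prob R u v * (p powi (-2) - 1))"
  proof (intro mult_left_mono prod_mono)
    fix e assume "e \<in> ?Q"
    obtain u v where e: "e = (u, v)" by (cases e)
    have "p powi (-2) = 1 / p\<^sup>2" by (simp add: power_int_minus divide_inverse)
    then have "k u v \<le> meeting_prob R u v * (p powi (-2) - 1)"
      using mult_left_mono[OF regular_meeting_prob_le[of R u v] c] by (simp add: k_def mult.commute)
    with k(2)[of u v] show "0 \<le> (case e of (u, v) \<Rightarrow> 1 + k u v) \<and> (case e of (u, v) \<Rightarrow> 1 + k u v)
        \<le> (case e of (u, v) \<Rightarrow> 1 + meeting_prob R u v * (p powi (-2) - 1))"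
      by (simp add: e)
  qed (use p in simp)
  finally show ?thesis by (simp add: G_def A_def p_def)
qed

end
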